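(* Let $\alpha_1>-1$ and $\alpha>-\min(1,1+\alpha_1)$, and let $\{m^{\rm L}_{p,0}\}_{p\ge0}$ be the limiting moments of the Laguerre $\beta$-ensemble with $\beta=2\alpha/N$ (see context). Then $m_{0,0}^{\rm L}=1$ and, for all integers $p\ge0$, $$m_{p+1,0}^{\rm L}=(p+1+\alpha_1+\alpha)\,m_{p,0}^{\rm L}+\alpha\sum_{s=0}^{p-1}m_{s,0}^{\rm L}\,m_{p-s,0}^{\rm L}.$$
   Context: The Laguerre $\beta$-ensemble is the probability density on $(0,\infty)^N$ proportional to $\prod_{l=1}^N\lambda_l^{\alpha_1}e^{-\lambda_l}\prod_{1\le j<k\le N}|\lambda_k-\lambda_j|^\beta$. Here $\beta=2\alpha/N$ with $\alpha,\alpha_1$ fixed, and $N\to\infty$. Standing assumption (large-$N$ ansatz): for every $n\ge1$ and all integers $p_1,\dots,p_n\ge0$, the joint cumulant of $\sum_j\lambda_j^{p_1},\dots,\sum_j\lambda_j^{p_n}$ (with $\beta=2\alpha/N$) has, as $N\to\infty$, an asymptotic expansion $N\sum_{l\ge0}c^{(l)}_{p_1,\dots,p_n}N^{-l}$ with coefficients independent of $N$. $m^{\rm L}_{p,0}=\lim_{N\to\infty}\frac1N\big\langle\sum_{j=1}^N\lambda_j^p\big\rangle$. Empty sums are zero. *)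

theory Defs
  imports "HOL-Analysis.Analysis" "HOL-Library.Landau_Symbols" "HOL-Library.Disjoint_Sets"
begin

definition laguerre_weight :: "real \<Rightarrow> real \<Rightarrow> nat \<Rightarrow> (nat \<Rightarrow> real) \<Rightarrow> real" where
  "laguerre_weight \<alpha>\<^sub>1 \<beta> N x =
     (if \<forall>l<N. 0 < x l
      then (\<Prod>l<N. x l powr \<alpha>\<^sub>1 * exp (- x l)) * (\<Prod>k<N. \<Prod>j<k. \<bar>x k - x j\<bar> powr \<beta>)
      else 0)"

definition laguerre_ensemble :: "real \<Rightarrow> real \<Rightarrow> nat \<Rightarrow> (nat \<Rightarrow> real) measure" where
  "laguerre_ensemble \<alpha>\<^sub>1 \<beta> N =
     (let L = (\<Pi>\<^sub>M l\<in>{..<N}. (lborel :: real measure));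
          Z = integral\<^sup>L L (laguerre_weight \<alpha>\<^sub>1 \<beta> N)
      in density L (\<lambda>x. ennreal (laguerre_weight \<alpha>\<^sub>1 \<beta> N x / Z)))"

definition power_sum :: "nat \<Rightarrow> nat \<Rightarrow> (nat \<Rightarrow> real) \<Rightarrow> real" where
  "power_sum N p x = (\<Sum>j<N. x j ^ p)"

text \<open>Joint cumulant of \<open>X 0, \<dots>, X (n - 1)\<close> under \<open>M\<close>, for \<open>n \<ge> 1\<close>, as the
  usual sum over set partitions of the index set.\<close>

definition joint_cumulant :: "'a measure \<Rightarrow> nat \<Rightarrow> (nat \<Rightarrow> 'a \<Rightarrow> real) \<Rightarrow> real" where
  "joint_cumulant M n X =
     (\<Sum>P | partition_on {..<n} P.
        (- 1) ^ (card P - 1) * fact (card P - 1) *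
        (\<Prod>B\<in>P. integral\<^sup>L M (\<lambda>x. \<Prod>i\<in>B. X i x)))"

text \<open>The asymptotic expansion is understood in the sense of Poincare: truncating after the
  \<open>l = K\<close> term leaves a remainder that is negligible compared with the scale of that term.\<close>

definition large_N_ansatz :: "real \<Rightarrow> real \<Rightarrow> bool" where
  "large_N_ansatz \<alpha>\<^sub>1 \<alpha> \<longleftrightarrow>
     (\<forall>n\<ge>1. \<forall>p :: nat \<Rightarrow> nat. \<exists>c :: nat \<Rightarrow> real. \<forall>K.
        (\<lambda>N. joint_cumulant (laguerre_ensemble \<alpha>\<^sub>1 (2 * \<alpha> / real N) N) n (\<lambda>i. power_sum N (p i))
              - real N * (\<Sum>l\<le>K. c l / real N ^ l))
          \<in> o(\<lambda>N. real N / real N ^ K))"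

definition mL0 :: "real \<Rightarrow> real \<Rightarrow> nat \<Rightarrow> real" where
  "mL0 \<alpha>\<^sub>1 \<alpha> p =
     lim (\<lambda>N. integral\<^sup>L (laguerre_ensemble \<alpha>\<^sub>1 (2 * \<alpha> / real N) N) (power_sum N p) / real N)"

text \<open>Under the ansatz the limit defining \<open>mL0\<close> exists, so \<open>lim\<close> is not a junk value there.\<close>

lemma partition_on_singleton: "partition_on {a} P \<longleftrightarrow> P = {{a}}"
proof
  assume P: "partition_on {a} P"
  then have U: "\<Union>P = {a}" and E: "{} \<notin> P" by (auto simp: partition_on_def)
  have "B = {a}" if "B \<in> P" for B
    using that U E by (metis Union_upper subset_singletonD)
  moreover have "P \<noteq> {}" using U by auto
  ultimately show "P = {{a}}" by blast
qed (auto simp: partition_on_def disjoint_def)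

lemma joint_cumulant_1: "joint_cumulant M 1 X = integral\<^sup>L M (X 0)"
proof -
  have "{..<1::nat} = {0}" by auto
  then show ?thesis
    by (simp only: joint_cumulant_def partition_on_singleton) simp
qed

lemma tendsto_mL0:
  assumes "large_N_ansatz \<alpha>\<^sub>1 \<alpha>"
  shows "(\<lambda>N. integral\<^sup>L (laguerre_ensemble \<alpha>\<^sub>1 (2 * \<alpha> / real N) N) (power_sum N p) / real N)
           \<longlonglongrightarrow> mL0 \<alpha>\<^sub>1 \<alpha> p"
proof -
  let ?E = "\<lambda>N. integral\<^sup>L (laguerre_ensemble \<alpha>\<^sub>1 (2 * \<alpha> / real N) N) (power_sum N p)"
  have "\<exists>c :: nat \<Rightarrow> real. \<forall>K.
      (\<lambda>N. joint_cumulant (laguerre_ensemble \<alpha>\<^sub>1 (2 * \<alpha> / real N) N) 1 (\<lambda>_. power_sum N p)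
              - real N * (\<Sum>l\<le>K. c l / real N ^ l)) \<in> o(\<lambda>N. real N / real N ^ K)"
    using assms[unfolded large_N_ansatz_def, rule_format, where n = 1 and p = "\<lambda>_. p"] by simp
  then obtain c :: "nat \<Rightarrow> real" where c:
    "\<forall>K. (\<lambda>N. joint_cumulant (laguerre_ensemble \<alpha>\<^sub>1 (2 * \<alpha> / real N) N) 1 (\<lambda>_. power_sum N p)
              - real N * (\<Sum>l\<le>K. c l / real N ^ l)) \<in> o(\<lambda>N. real N / real N ^ K)"
    by (rule exE)
  from c[rule_format, of 0] have "(\<lambda>N. ?E N - real N * c 0) \<in> o(\<lambda>N. real N)"
    by (simp add: joint_cumulant_1[simplified])
  then have "(\<lambda>N. (?E N - real N * c 0) / real N) \<longlonglongrightarrow> 0"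
    by (rule smalloD_tendsto)
  then have "(\<lambda>N. (?E N - real N * c 0) / real N + c 0) \<longlonglongrightarrow> 0 + c 0"
    by (intro tendsto_intros)
  moreover have "eventually (\<lambda>N. (?E N - real N * c 0) / real N + c 0 = ?E N / real N) sequentially"
    using eventually_gt_at_top[of 0] by eventually_elim (simp add: field_simps)
  ultimately have "(\<lambda>N. ?E N / real N) \<longlonglongrightarrow> c 0"
    by (simp add: tendsto_cong)
  then show ?thesis
    unfolding mL0_def by (simp add: limI)
qed

end

(* Move every eigenvalue by x -> x + e x^(p+1). The change-of-variables formula says that weight
   times Jacobian has the same integral for all e >= 0. Its ratio to the original weight is
   a smooth function of e even for negative beta, because (y^(p+1) - x^(p+1)) / (y - x) is a
   polynomial, so differentiating at e = 0 under the integral gives the loop equation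
     (p+1+a1) <p_p> - <p_(p+1)> + (a/N) (sum_(s<=p) <p_s p_(p-s)> - (p+1) <p_p>) = 0,
   where p_s is the s-th power sum. After division by N, the case n = 2 of the ansatz factorizes
   the two-point averages in the limit, and the s = p term is the summand a * m_p. *)

theory Submission imports Defs
begin

section \<open>Change of variables on the half-line\<close>

text \<open>Integrating total derivatives by parts would leave boundary terms to control at 0, where
  \<open>\<alpha>\<^sub>1\<close> may be negative, and at collisions, where \<beta> may be. The
  substitution has none: it fixes 0 and preserves the order of the eigenvalues. For p > 0 it maps
  the half-line bijectively to itself only when \<epsilon> \<ge> 0, but a one-sided sequence already
  determines the derivative at 0. The price is a dominating function free of \<epsilon>. A power of
  the product of all 1 + x_l serves, so what is needed is that the weight times any such power is
  integrable. For negative \<alpha> that is the hard point, since the pair singularities of N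
  variables overlap. Comparison with stars decouples them: given the centre, each leaf sees only the
  singularities at 0 and at the centre, of exponents \<open>\<alpha>\<^sub>1\<close> and \<alpha>.
  These merge as the centre tends to 0, whence the condition
  \<open>\<alpha> > - min 1 (1 + \<alpha>\<^sub>1)\<close>.\<close>

lemma nn_integral_substitution_half_line:
  fixes g g' :: "real \<Rightarrow> real" and f :: "real \<Rightarrow> ennreal"
  assumes f: "f \<in> borel_measurable borel"
    and deriv: "\<And>x. x \<ge> 0 \<Longrightarrow> (g has_real_derivative g' x) (at x)"
    and cont: "continuous_on UNIV g'"
    and nonneg: "\<And>x. x \<ge> 0 \<Longrightarrow> g' x \<ge> 0"
    and g_meas: "g \<in> borel_measurable borel"
    and g0: "g 0 = 0"
    and gtop: "filterlim g at_top at_top"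
  shows "(\<integral>\<^sup>+y. f y * indicator {0<..} y \<partial>lborel) =
         (\<integral>\<^sup>+y. f (g y) * ennreal (g' y) * indicator {0<..} y \<partial>lborel)"
proof -
  have [measurable]: "g' \<in> borel_measurable borel"
    using cont by (rule borel_measurable_continuous_onI)
  note [measurable] = f g_meas
  have mono: "g x \<le> g y" if "0 \<le> x" "x \<le> y" for x y
    by (rule DERIV_nonneg_imp_nondecreasing[OF that(2)]) (metis deriv nonneg order_trans that(1))
  \<comment> \<open>Once \<open>D\<close>, the image under \<open>g\<close> of the density
    \<open>g'\<close>, is identified with Lebesgue measure on the half-line by testing sets, the
    formula for a general \<open>f\<close> is integration against one and the same measure.
    Monotonicity of \<open>g\<close> suffices for this.\<close>
  define D where "D = distr (density lborel (\<lambda>y. ennreal (g' y) * indicator {0..} y)) borel g"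
  have "density lborel (indicator {0..}) = D"
  proof (rule measure_eqI)
    show "sets (density lborel (indicator {0..})) = sets D" by (simp add: D_def)
    fix A :: "real set" assume "A \<in> sets (density lborel (indicator {0..}))"
    then have A[measurable]: "A \<in> sets borel" by simp
    have fin: "(\<integral>\<^sup>+y. indicator A y * indicator {0..g (real n)} y \<partial>lborel) =
               (\<integral>\<^sup>+y. indicator A (g y) * ennreal (g' y) * indicator {0..real n} y \<partial>lborel)" for n
    proof -
      have "(\<integral>\<^sup>+x. ennreal (indicator A x * indicator {g 0..g (real n)} x) \<partial>lborel) =
             (\<integral>\<^sup>+x. ennreal (indicator A (g x) * g' x * indicator {0..real n} x) \<partial>lborel)"
        by (rule nn_integral_substitution)
          (use deriv nonneg in \<open>auto intro: continuous_on_subset[OF cont] simp: set_borel_measurable_def\<close>)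
      moreover have "ennreal (indicator A x * indicator {g 0..g (real n)} x) = indicator A x * indicator {0..g (real n)} x"
        and "ennreal (indicator A (g x) * g' x * indicator {0..real n} x) = indicator A (g x) * ennreal (g' x) * indicator {0..real n} x" for x
        by (auto simp: indicator_def g0)
      ultimately show ?thesis by simp
    qed
    \<comment> \<open>Monotone convergence on both sides of the formula for compact intervals. The
      intervals \<open>{0..g (real n)}\<close> exhaust the half-line because \<open>g\<close> tends
      to infinity.\<close>
    have "incseq (\<lambda>n y. indicator A y * indicator {0..g (real n)} y :: ennreal)"
      using mono by (auto simp: incseq_def le_fun_def indicator_def intro: order_trans)
    then have 1: "(\<lambda>n. \<integral>\<^sup>+y. indicator A y * indicator {0..g (real n)} y \<partial>lborel) \<longlonglongrightarrow>
              (\<integral>\<^sup>+y. indicator A y * indicator {0..} y \<partial>lborel)"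
    proof (rule nn_integral_LIMSEQ)
      fix y :: real
      have "eventually (\<lambda>n. y \<le> g (real n)) sequentially"
        using filterlim_compose[OF gtop filterlim_real_sequentially] by (simp add: filterlim_at_top)
      then show "(\<lambda>n. indicator A y * indicator {0..g (real n)} y :: ennreal) \<longlonglongrightarrow> indicator A y * indicator {0..} y"
        by (intro tendsto_eventually, elim eventually_mono) (auto simp: indicator_def)
    qed auto
    have "incseq (\<lambda>n y. indicator A (g y) * ennreal (g' y) * indicator {0..real n} y :: ennreal)"
      by (auto simp: incseq_def le_fun_def indicator_def)
    then have 2: "(\<lambda>n. \<integral>\<^sup>+y. indicator A (g y) * ennreal (g' y) * indicator {0..real n} y \<partial>lborel) \<longlonglongrightarrow>
              (\<integral>\<^sup>+y. indicator A (g y) * ennreal (g' y) * indicator {0..} y \<partial>lborel)"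
    proof (rule nn_integral_LIMSEQ)
      fix y :: real
      have "eventually (\<lambda>n. y \<le> real n) sequentially"
        using filterlim_real_sequentially by (simp add: filterlim_at_top)
      then show "(\<lambda>n. indicator A (g y) * ennreal (g' y) * indicator {0..real n} y :: ennreal)
         \<longlonglongrightarrow> indicator A (g y) * ennreal (g' y) * indicator {0..} y"
        by (intro tendsto_eventually, elim eventually_mono) (auto simp: indicator_def)
    qed auto
    have "(\<integral>\<^sup>+y. indicator A y * indicator {0..} y \<partial>lborel) =
      (\<integral>\<^sup>+y. indicator A (g y) * ennreal (g' y) * indicator {0..} y \<partial>lborel)"
      using LIMSEQ_unique[OF 1] 2 by (simp add: fin)
    moreover have "emeasure D A = (\<integral>\<^sup>+y. indicator A (g y) * ennreal (g' y) * indicator {0..} y \<partial>lborel)"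
    proof -
      have "emeasure D A = (\<integral>\<^sup>+y. indicator A y \<partial>D)"
        by (simp add: D_def)
      also have "\<dots> = (\<integral>\<^sup>+y. (ennreal (g' y) * indicator {0..} y) * indicator A (g y) \<partial>lborel)"
        unfolding D_def by (subst nn_integral_distr) (simp_all add: nn_integral_density del: nn_integral_indicator)
      finally show ?thesis by (simp add: mult_ac)
    qed
    moreover have "emeasure (density lborel (indicator {0..})) A = (\<integral>\<^sup>+y. indicator A y * indicator {0..} y \<partial>lborel)"
      by (subst emeasure_density) (auto simp: mult_ac)
    ultimately show "emeasure (density lborel (indicator {0..})) A = emeasure D A" by simp
  qed
  then have "(\<integral>\<^sup>+y. f y \<partial>density lborel (indicator {0..})) = (\<integral>\<^sup>+y. f y \<partial>D)" by simp
  also have "(\<integral>\<^sup>+y. f y \<partial>D) = (\<integral>\<^sup>+y. f (g y) * ennreal (g' y) * indicator {0..} y \<partial>lborel)"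
    by (simp add: D_def nn_integral_distr nn_integral_density mult_ac)
  \<comment> \<open>Compact intervals lead to the closed half-line, whereas the weight lives on the
    open one; the difference is a null set.\<close>
  also have "\<dots> = (\<integral>\<^sup>+y. f (g y) * ennreal (g' y) * indicator {0<..} y \<partial>lborel)"
    by (rule nn_integral_cong_AE, rule AE_mp[OF AE_lborel_singleton[of 0]]) (auto simp: indicator_def)
  also have "(\<integral>\<^sup>+y. f y \<partial>density lborel (indicator {0..})) = (\<integral>\<^sup>+y. f y * indicator {0..} y \<partial>lborel)"
    by (simp add: nn_integral_density mult_ac)
  also have "\<dots> = (\<integral>\<^sup>+y. f y * indicator {0<..} y \<partial>lborel)"
    by (rule nn_integral_cong_AE, rule AE_mp[OF AE_lborel_singleton[of 0]]) (auto simp: indicator_def)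
  finally show ?thesis .
qed

text \<open>Tonelli reduces the claim to one coordinate at a time. The image point is restricted to
  \<open>I\<close> because points of the product space are extensional.\<close>

lemma nn_integral_PiM_substitution_half_line:
  fixes g g' :: "real \<Rightarrow> real" and f :: "('i \<Rightarrow> real) \<Rightarrow> ennreal"
  assumes "finite I"
    and f: "f \<in> borel_measurable (PiM I (\<lambda>_. lborel))"
    and deriv: "\<And>x. x \<ge> 0 \<Longrightarrow> (g has_real_derivative g' x) (at x)"
    and cont: "continuous_on UNIV g'"
    and nonneg: "\<And>x. x \<ge> 0 \<Longrightarrow> g' x \<ge> 0"
    and g_meas: "g \<in> borel_measurable borel"
    and g0: "g 0 = 0"
    and gtop: "filterlim g at_top at_top"
  shows "(\<integral>\<^sup>+x. f x * (\<Prod>i\<in>I. indicator {0<..} (x i)) \<partial>PiM I (\<lambda>_. lborel)) =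
         (\<integral>\<^sup>+x. f (\<lambda>i\<in>I. g (x i)) * (\<Prod>i\<in>I. ennreal (g' (x i)) * indicator {0<..} (x i)) \<partial>PiM I (\<lambda>_. lborel))"
  using assms(1,2)
proof (induction I arbitrary: f)
  case empty
  then show ?case by (simp add: PiM_empty nn_integral_count_space_finite)
next
  case (insert i I)
  interpret product_sigma_finite "\<lambda>_::'i. lborel :: real measure" ..
  have g'_meas[measurable]: "g' \<in> borel_measurable borel"
    using cont by (rule borel_measurable_continuous_onI)
  note [measurable] = insert.prems g_meas
  have upd_meas [measurable]: "(\<lambda>x. x(i := y)) \<in> measurable (PiM I (\<lambda>_. lborel)) (PiM (insert i I) (\<lambda>_. lborel))" for y :: real
    by (rule measurable_fun_upd[where J=I]) auto
  have upd2: "(\<lambda>y. x(i := y)) \<in> measurable borel (PiM (insert i I) (\<lambda>_. lborel))"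
    if "x \<in> space (PiM I (\<lambda>_. lborel))" for x :: "'i \<Rightarrow> real"
    by (rule measurable_fun_upd[where J=I]) (use that in auto)
  have T[measurable]: "(\<lambda>x. \<lambda>j\<in>J. g (x j)) \<in> measurable (PiM J (\<lambda>_. lborel)) (PiM J (\<lambda>_. lborel))" for J :: "'i set"
    by (rule measurable_restrict) measurable
  let ?P = "\<lambda>I x. \<Prod>j\<in>I. indicator {0<..} (x j :: real) :: ennreal"
  let ?G = "\<lambda>I x. \<Prod>j\<in>I. ennreal (g' (x j)) * indicator {0<..} (x j :: real) :: ennreal"
  have [simp]: "?P I (x(i := y)) = ?P I x" "?G I (x(i := y)) = ?G I x" for x y
    using insert.hyps by (auto intro!: prod.cong)
  have "(\<integral>\<^sup>+x. f x * ?P (insert i I) x \<partial>PiM (insert i I) (\<lambda>_. lborel)) =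
        (\<integral>\<^sup>+x. \<integral>\<^sup>+y. f (x(i := y)) * indicator {0<..} y * ?P I x \<partial>lborel \<partial>PiM I (\<lambda>_. lborel))"
    using insert.hyps by (subst product_nn_integral_insert) (auto simp del: fun_upd_apply simp: fun_upd_same mult_ac)
  also have "\<dots> = (\<integral>\<^sup>+x. (\<integral>\<^sup>+y. f (x(i := y)) * indicator {0<..} y \<partial>lborel) * ?P I x \<partial>PiM I (\<lambda>_. lborel))"
  proof (intro nn_integral_cong nn_integral_multc)
    fix x assume "x \<in> space (PiM I (\<lambda>_. lborel :: real measure))"
    note [measurable] = upd2[OF this]
    show "(\<lambda>y. f (x(i := y)) * indicator {0<..} y) \<in> borel_measurable lborel" by measurable
  qed
  also have "\<dots> = (\<integral>\<^sup>+x. (\<integral>\<^sup>+y. f (x(i := g y)) * ennreal (g' y) * indicator {0<..} y \<partial>lborel) * ?P I x \<partial>PiM I (\<lambda>_. lborel))"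
  proof (rule nn_integral_cong)
    fix x assume "x \<in> space (PiM I (\<lambda>_. lborel :: real measure))"
    note [measurable] = upd2[OF this]
    have "(\<integral>\<^sup>+y. f (x(i := y)) * indicator {0<..} y \<partial>lborel) =
          (\<integral>\<^sup>+y. f (x(i := g y)) * ennreal (g' y) * indicator {0<..} y \<partial>lborel)"
      by (rule nn_integral_substitution_half_line) (use deriv cont nonneg g_meas g0 gtop in auto)
    then show "(\<integral>\<^sup>+y. f (x(i := y)) * indicator {0<..} y \<partial>lborel) * ?P I x =
          (\<integral>\<^sup>+y. f (x(i := g y)) * ennreal (g' y) * indicator {0<..} y \<partial>lborel) * ?P I x"
      by (rule arg_cong)
  qed
  \<comment> \<open>The induction hypothesis is applied to the inner integral, already transformed
    in coordinate \<open>i\<close>, as a function of the other coordinates; hence the generalization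
    over \<open>f\<close>.\<close>
  also have "\<dots> = (\<integral>\<^sup>+x. (\<integral>\<^sup>+y. f ((\<lambda>j\<in>I. g (x j))(i := g y)) * ennreal (g' y) * indicator {0<..} y \<partial>lborel) * ?G I x \<partial>PiM I (\<lambda>_. lborel))"
    by (rule insert.IH) measurable
  also have "\<dots> = (\<integral>\<^sup>+x. \<integral>\<^sup>+y. f ((\<lambda>j\<in>I. g (x j))(i := g y)) * ennreal (g' y) * indicator {0<..} y * ?G I x \<partial>lborel \<partial>PiM I (\<lambda>_. lborel))"
  proof (intro nn_integral_cong nn_integral_multc[symmetric])
    fix x :: "'i \<Rightarrow> real" assume "x \<in> space (PiM I (\<lambda>_. lborel :: real measure))"
    have "(\<lambda>j\<in>I. g (x j)) \<in> space (PiM I (\<lambda>_. lborel :: real measure))" by (simp add: space_PiM)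
    note [measurable] = upd2[OF this]
    show "(\<lambda>y. f ((\<lambda>j\<in>I. g (x j))(i := g y)) * ennreal (g' y) * indicator {0<..} y) \<in> borel_measurable lborel" by measurable
  qed
  also have "\<dots> = (\<integral>\<^sup>+x. f (\<lambda>j\<in>insert i I. g (x j)) * ?G (insert i I) x \<partial>PiM (insert i I) (\<lambda>_. lborel))"
  proof -
    have eq: "(\<lambda>j\<in>I. g (x j))(i := g y) = (\<lambda>j\<in>insert i I. g ((x(i := y)) j))" for x y
      using insert.hyps by (auto simp: restrict_def fun_eq_iff)
    show ?thesis
      using insert.hyps unfolding eq
      by (subst product_nn_integral_insert) (auto simp del: fun_upd_apply simp: fun_upd_same mult_ac)
  qed
  finally show ?case .
qed

section \<open>Integrability of the weight\<close>

text \<open>Since (1 + y)^m \<le> 2^m (1 + y^m), the integrand is dominated by two Gamma integrands,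
  with the positive parameters c + 1 and c + 1 + m.\<close>

lemma nn_integral_powr_exp_finite:
  fixes c :: real
  assumes "c > -1"
  shows "(\<integral>\<^sup>+y. ennreal (y powr c * (1 + y) ^ m * exp (- y)) * indicator {0<..} y \<partial>lborel) < \<infinity>"
proof -
  define G where "G s t = ennreal (indicator {0..} t * t powr (s - 1) / exp t)" for s t :: real
  have [measurable]: "G s \<in> borel_measurable borel" for s unfolding G_def[abs_def] by measurable
  have G: "(\<integral>\<^sup>+t. G s t \<partial>lborel) < \<infinity>" if "s > 0" for s :: real
    using Gamma_conv_nn_integral_real[OF that] by (simp add: G_def flip: top.not_eq_extremum) (metis ennreal_neq_top)
  have "(\<integral>\<^sup>+y. ennreal (y powr c * (1 + y) ^ m * exp (- y)) * indicator {0<..} y \<partial>lborel) \<le>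
        (\<integral>\<^sup>+y. ennreal (2 ^ m) * (G (c + 1) y + G (c + 1 + m) y) \<partial>lborel)"
  proof (rule nn_integral_mono)
    fix y :: real
    show "ennreal (y powr c * (1 + y) ^ m * exp (- y)) * indicator {0<..} y \<le>
        ennreal (2 ^ m) * (G (c + 1) y + G (c + 1 + m) y)"
    proof (cases "y > 0")
      case True
      have "(1 + y) ^ m \<le> 2 ^ m * (1 + y ^ m)"
      proof (cases "y \<le> 1")
        case True
        with \<open>y > 0\<close> have "(1 + y) ^ m \<le> 2 ^ m" by (intro power_mono) auto
        also have "\<dots> \<le> 2 ^ m * (1 + y ^ m)" using \<open>y > 0\<close> by simp
        finally show ?thesis .
      next
        case False
        then have "(1 + y) ^ m \<le> (2 * y) ^ m" by (intro power_mono) auto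
        also have "\<dots> \<le> 2 ^ m * (1 + y ^ m)" by (simp add: power_mult_distrib)
        finally show ?thesis .
      qed
      then have "y powr c * (1 + y) ^ m * exp (- y) \<le> y powr c * (2 ^ m * (1 + y ^ m)) * exp (- y)"
        by (intro mult_right_mono mult_left_mono) auto
      also have "\<dots> = 2 ^ m * (y powr c / exp y + y powr (c + m) / exp y)"
        using True by (simp add: powr_add powr_realpow exp_minus field_simps)
      finally show ?thesis
        using True by (simp add: G_def ennreal_leI add_ac flip: ennreal_mult' ennreal_plus)
    qed simp
  qed
  also have "\<dots> = ennreal (2 ^ m) * ((\<integral>\<^sup>+y. G (c + 1) y \<partial>lborel) + (\<integral>\<^sup>+y. G (c + 1 + m) y \<partial>lborel))"
    by (simp add: nn_integral_cmult nn_integral_add)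
  also have "\<dots> < \<infinity>"
    using G[of "c + 1"] G[of "c + 1 + m"] assms by (simp add: ennreal_mult_less_top)
  finally show ?thesis .
qed

text \<open>Raise t \<le> exp t at t = (1 + y) / (m + 1) to the power m. The denominator m + 1
  instead of m covers m = 0.\<close>

lemma one_plus_power_exp_bounded: "\<exists>K\<ge>0. \<forall>y\<ge>0. (1 + y) ^ m * exp (- y) \<le> (K :: real)"
proof (intro exI conjI allI impI)
  show "(0::real) \<le> real (m + 1) ^ m * exp 1" by simp
  fix y :: real assume y: "y \<ge> 0"
  have "((1 + y) / real (m + 1)) ^ m \<le> exp ((1 + y) / real (m + 1)) ^ m"
  proof (rule power_mono)
    show "(1 + y) / real (m + 1) \<le> exp ((1 + y) / real (m + 1))"
      using exp_ge_add_one_self[of "(1 + y) / real (m + 1)"] by linarith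
  qed (use y in simp)
  also have "\<dots> = exp (real m * ((1 + y) / real (m + 1)))" by (rule exp_of_nat_mult[symmetric])
  also have "\<dots> \<le> exp (1 + y)" using y by (simp add: field_simps)
  finally have "(1 + y) ^ m \<le> real (m + 1) ^ m * exp (1 + y)"
    by (simp add: power_divide divide_le_eq mult.commute)
  then have "(1 + y) ^ m * exp (- y) \<le> real (m + 1) ^ m * exp (1 + y) * exp (- y)"
    by (intro mult_right_mono) auto
  also have "\<dots> = real (m + 1) ^ m * exp 1" by (simp add: exp_add exp_minus)
  finally show "(1 + y) ^ m * exp (- y) \<le> real (m + 1) ^ m * exp 1" .
qed

text \<open>Only exponents below \<open>0\<close> are singular; there the smaller of \<open>y\<close> and \<open>\<bar>x - y\<bar>\<close> carries
  the whole singularity, of total exponent \<open>min \<alpha>\<^sub>1 0 + \<alpha> > - 1\<close>.\<close>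

lemma nn_integral_laguerre_factor_bound:
  fixes \<alpha> \<alpha>\<^sub>1 :: real
  assumes "\<alpha>\<^sub>1 > - 1" "\<alpha> > - min 1 (1 + \<alpha>\<^sub>1)"
  shows "\<exists>C\<ge>0. \<exists>M. \<forall>x>0.
    (\<integral>\<^sup>+y. ennreal (y powr \<alpha>\<^sub>1 * (1 + y) ^ m * exp (- y) * \<bar>x - y\<bar> powr \<alpha>) * indicator {0<..} y \<partial>lborel)
      \<le> ennreal (C * (1 + x) ^ M)"
proof (cases "\<alpha> \<ge> 0")
  case True
  define M where "M = nat \<lceil>\<alpha>\<rceil>"
  have M: "\<alpha> \<le> real M" unfolding M_def by linarith
  define J where "J = (\<integral>\<^sup>+y. ennreal (y powr \<alpha>\<^sub>1 * (1 + y) ^ (m + M) * exp (- y)) * indicator {0<..} y \<partial>lborel)"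
  have J: "J < \<infinity>" unfolding J_def by (rule nn_integral_powr_exp_finite) (use assms in auto)
  show ?thesis
  proof (intro exI[of _ "enn2real J"] exI[of _ M] conjI allI impI)
    fix x :: real assume x: "x > 0"
    have "(\<integral>\<^sup>+y. ennreal (y powr \<alpha>\<^sub>1 * (1 + y) ^ m * exp (- y) * \<bar>x - y\<bar> powr \<alpha>) * indicator {0<..} y \<partial>lborel)
      \<le> (\<integral>\<^sup>+y. ennreal ((1 + x) ^ M) * (ennreal (y powr \<alpha>\<^sub>1 * (1 + y) ^ (m + M) * exp (- y)) * indicator {0<..} y) \<partial>lborel)"
    proof (rule nn_integral_mono)
      fix y :: real
      show "ennreal (y powr \<alpha>\<^sub>1 * (1 + y) ^ m * exp (- y) * \<bar>x - y\<bar> powr \<alpha>) * indicator {0<..} y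
        \<le> ennreal ((1 + x) ^ M) * (ennreal (y powr \<alpha>\<^sub>1 * (1 + y) ^ (m + M) * exp (- y)) * indicator {0<..} y)"
      proof (cases "y > 0")
        case y: True
        \<comment> \<open>The base (1 + x)(1 + y) is at least 1, so the exponent may be rounded up
          to a natural number and the bound splits into a factor in x and a factor in y.\<close>
        have "\<bar>x - y\<bar> powr \<alpha> \<le> ((1 + x) * (1 + y)) powr \<alpha>"
          using x y True by (intro powr_mono2) (auto simp: algebra_simps abs_if)
        also have "\<dots> \<le> ((1 + x) * (1 + y)) powr real M"
          using x y M by (intro powr_mono) (auto simp: algebra_simps)
        also have "\<dots> = (1 + x) ^ M * (1 + y) ^ M"
          using x y by (simp add: powr_realpow power_mult_distrib)
        finally have "y powr \<alpha>\<^sub>1 * (1 + y) ^ m * exp (- y) * \<bar>x - y\<bar> powr \<alpha> \<le>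
            y powr \<alpha>\<^sub>1 * (1 + y) ^ m * exp (- y) * ((1 + x) ^ M * (1 + y) ^ M)"
          using y by (intro mult_left_mono) auto
        also have "\<dots> = (1 + x) ^ M * (y powr \<alpha>\<^sub>1 * (1 + y) ^ (m + M) * exp (- y))"
          by (simp add: power_add)
        finally show ?thesis using x y by (simp add: ennreal_leI flip: ennreal_mult')
      qed simp
    qed
    also have "\<dots> = ennreal ((1 + x) ^ M) * J"
      by (simp add: nn_integral_cmult J_def)
    also have "\<dots> = ennreal (enn2real J * (1 + x) ^ M)"
      using J x by (simp add: ennreal_mult'' mult.commute)
    finally show "(\<integral>\<^sup>+y. ennreal (y powr \<alpha>\<^sub>1 * (1 + y) ^ m * exp (- y) * \<bar>x - y\<bar> powr \<alpha>) * indicator {0<..} y \<partial>lborel)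
      \<le> ennreal (enn2real J * (1 + x) ^ M)" .
  qed simp
next
  case False
  \<comment> \<open>The negative part of \<open>\<alpha>\<^sub>1\<close>. The remaining exponent
    \<open>\<alpha>\<^sub>1 - b\<close> is nonnegative and is absorbed into the power of 1 + y,
    which makes up \<open>M\<close>.\<close>
  define b where "b = min \<alpha>\<^sub>1 0"
  define c where "c = b + \<alpha>"
  have c: "c > -1" "c < 0" "b \<le> 0" "b \<le> \<alpha>\<^sub>1" using assms False by (auto simp: c_def b_def min_def split: if_splits)
  define M where "M = m + nat \<lceil>\<alpha>\<^sub>1 - b\<rceil>"
  have M: "\<alpha>\<^sub>1 - b \<le> real (nat \<lceil>\<alpha>\<^sub>1 - b\<rceil>)" by linarith
  obtain K :: real where K: "K \<ge> 0" "\<And>y. y \<ge> 0 \<Longrightarrow> (1 + y) ^ M * exp (- y) \<le> K"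
    using one_plus_power_exp_bounded by blast
  define v where "v y = (1 + y) ^ M * exp (- y)" for y :: real
  \<comment> \<open>A kernel with the singularity at the centre and an integrable tail. Its integral
    over the line is unaffected by translation, which makes the final bound uniform in x.\<close>
  define k where "k t = \<bar>t\<bar> powr c * exp (- \<bar>t\<bar>)" for t :: real
  define J1 where "J1 = (\<integral>\<^sup>+y. ennreal (y powr c * (1 + y) ^ M * exp (- y)) * indicator {0<..} y \<partial>lborel)"
  define J2 where "J2 = (\<integral>\<^sup>+y. ennreal (y powr 0 * (1 + y) ^ M * exp (- y)) * indicator {0<..} y \<partial>lborel)"
  define J3 where "J3 = (\<integral>\<^sup>+t. ennreal (k t) \<partial>lborel)"
  have [measurable]: "k \<in> borel_measurable borel" unfolding k_def by measurable
  have J12: "J1 < \<infinity>" "J2 < \<infinity>"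
    unfolding J1_def J2_def by (rule nn_integral_powr_exp_finite; use c in simp)+
  have J3: "J3 < \<infinity>"
  proof -
    define H where "H = (\<integral>\<^sup>+y. ennreal (y powr c * (1 + y) ^ 0 * exp (- y)) * indicator {0<..} y \<partial>lborel)"
    have H: "H < \<infinity>" unfolding H_def by (rule nn_integral_powr_exp_finite) (use c in auto)
    have H': "H = (\<integral>\<^sup>+t. ennreal (k (- t)) * indicator {0<..} (- t) \<partial>lborel)"
      unfolding H_def by (subst nn_integral_real_affine[where c = "-1" and t = 0])
        (auto intro!: nn_integral_cong simp: k_def indicator_def)
    have "J3 \<le> (\<integral>\<^sup>+t. ennreal (k t) * indicator {0<..} t + ennreal (k (- t)) * indicator {0<..} (- t) \<partial>lborel)"
      unfolding J3_def by (rule nn_integral_mono) (auto simp: indicator_def k_def)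
    also have "\<dots> = (\<integral>\<^sup>+t. ennreal (k t) * indicator {0<..} t \<partial>lborel) + H"
      unfolding H' by (rule nn_integral_add) auto
    also have "(\<integral>\<^sup>+t. ennreal (k t) * indicator {0<..} t \<partial>lborel) = H"
      unfolding H_def by (auto intro!: nn_integral_cong simp: k_def indicator_def)
    finally show ?thesis using H by (simp add: order_le_less_trans)
  qed
  define C where "C = J1 + (J2 + ennreal (K * exp 1) * J3)"
  have C: "C < \<infinity>" unfolding C_def using J12 J3 by (simp add: ennreal_mult_less_top)
  show ?thesis
  proof (intro exI[of _ "enn2real C"] exI[of _ 0] conjI allI impI)
    fix x :: real assume x: "x > 0"
    have "(\<integral>\<^sup>+y. ennreal (y powr \<alpha>\<^sub>1 * (1 + y) ^ m * exp (- y) * \<bar>x - y\<bar> powr \<alpha>) * indicator {0<..} y \<partial>lborel)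
      \<le> (\<integral>\<^sup>+y. ennreal (y powr c * (1 + y) ^ M * exp (- y)) * indicator {0<..} y +
          (ennreal (y powr 0 * (1 + y) ^ M * exp (- y)) * indicator {0<..} y + ennreal (K * exp 1) * ennreal (k (x - y))) \<partial>lborel)"
    proof (rule nn_integral_mono)
      fix y :: real
      show "ennreal (y powr \<alpha>\<^sub>1 * (1 + y) ^ m * exp (- y) * \<bar>x - y\<bar> powr \<alpha>) * indicator {0<..} y
        \<le> ennreal (y powr c * (1 + y) ^ M * exp (- y)) * indicator {0<..} y +
          (ennreal (y powr 0 * (1 + y) ^ M * exp (- y)) * indicator {0<..} y + ennreal (K * exp 1) * ennreal (k (x - y)))"
      proof (cases "y > 0")
        case y: True
        have v: "0 \<le> v y" "v y \<le> K" using y K by (auto simp: v_def)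
        have "y powr \<alpha>\<^sub>1 = y powr b * y powr (\<alpha>\<^sub>1 - b)" by (simp flip: powr_add)
        also have "y powr (\<alpha>\<^sub>1 - b) \<le> (1 + y) powr (\<alpha>\<^sub>1 - b)" using y c by (intro powr_mono2) auto
        also have "\<dots> \<le> (1 + y) powr real (nat \<lceil>\<alpha>\<^sub>1 - b\<rceil>)" using y M by (intro powr_mono) auto
        also have "\<dots> = (1 + y) ^ nat \<lceil>\<alpha>\<^sub>1 - b\<rceil>" using y by (simp add: powr_realpow)
        finally have "y powr \<alpha>\<^sub>1 \<le> y powr b * (1 + y) ^ nat \<lceil>\<alpha>\<^sub>1 - b\<rceil>"
          by (simp add: mult_left_mono)
        then have "y powr \<alpha>\<^sub>1 * ((1 + y) ^ m * exp (- y) * \<bar>x - y\<bar> powr \<alpha>) \<le>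
            (y powr b * (1 + y) ^ nat \<lceil>\<alpha>\<^sub>1 - b\<rceil>) * ((1 + y) ^ m * exp (- y) * \<bar>x - y\<bar> powr \<alpha>)"
          using y by (intro mult_right_mono) auto
        also have "\<dots> = (y powr b * \<bar>x - y\<bar> powr \<alpha>) * v y" by (simp add: v_def M_def power_add)
        also have "\<dots> \<le> (y powr c + \<bar>x - y\<bar> powr c) * v y"
        proof (intro mult_right_mono v)
          show "y powr b * \<bar>x - y\<bar> powr \<alpha> \<le> y powr c + \<bar>x - y\<bar> powr c"
          \<comment> \<open>At x = y the left side is 0, because \<open>0 powr \<alpha> = 0\<close>
            also for negative \<alpha>.\<close>
          proof (cases "x = y")
            case False
            show ?thesis
            proof (cases "y \<le> \<bar>x - y\<bar>")
              case True
              have "y powr b * \<bar>x - y\<bar> powr \<alpha> \<le> y powr b * y powr \<alpha>"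
                using True y \<open>\<not> \<alpha> \<ge> 0\<close> by (intro mult_left_mono powr_mono2') auto
              also have "\<dots> = y powr c" by (simp add: c_def powr_add)
              finally show ?thesis by (simp add: add_increasing2)
            next
              case *: False
              have "y powr b * \<bar>x - y\<bar> powr \<alpha> \<le> \<bar>x - y\<bar> powr b * \<bar>x - y\<bar> powr \<alpha>"
                using * y False c by (intro mult_right_mono powr_mono2') auto
              also have "\<dots> = \<bar>x - y\<bar> powr c" by (simp add: c_def powr_add)
              finally show ?thesis by (simp add: add_increasing)
            qed
          qed simp
        qed
        also have "\<dots> = y powr c * v y + \<bar>x - y\<bar> powr c * v y" by (simp add: algebra_simps)
        \<comment> \<open>Within distance 1 the factor \<open>exp 1\<close> compensates the decay
          built into \<open>k\<close>; beyond it the power is at most 1, as \<open>c\<close> is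
          negative.\<close>
        also have "\<bar>x - y\<bar> powr c * v y \<le> (1 + exp 1 * k (x - y)) * v y"
        proof (intro mult_right_mono v)
          show "\<bar>x - y\<bar> powr c \<le> 1 + exp 1 * k (x - y)"
          proof (cases "\<bar>x - y\<bar> \<le> 1")
            case True
            then have "\<bar>x - y\<bar> powr c * 1 \<le> \<bar>x - y\<bar> powr c * exp (1 - \<bar>x - y\<bar>)"
              by (intro mult_left_mono) auto
            also have "\<dots> = exp 1 * k (x - y)" by (simp add: k_def exp_diff exp_minus field_simps)
            finally show ?thesis by simp
          next
            case False
            then have "\<bar>x - y\<bar> powr c \<le> \<bar>x - y\<bar> powr 0" using c by (intro powr_mono) auto
            also have "\<dots> \<le> 1 + exp 1 * k (x - y)" using False by (auto simp: k_def)
            finally show ?thesis .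
          qed
        qed
        also have "(1 + exp 1 * k (x - y)) * v y = v y + v y * (exp 1 * k (x - y))"
          by (simp add: algebra_simps)
        \<comment> \<open>Replacing \<open>v y\<close> by the constant \<open>K\<close> leaves a
          pure translate of the reflected kernel, so no dependence on x survives
          integration.\<close>
        also have "v y * (exp 1 * k (x - y)) \<le> K * (exp 1 * k (x - y))"
          by (intro mult_right_mono v) (auto simp: k_def)
        finally have "y powr \<alpha>\<^sub>1 * (1 + y) ^ m * exp (- y) * \<bar>x - y\<bar> powr \<alpha> \<le>
          y powr c * v y + (v y + K * exp 1 * k (x - y))" by (simp add: mult_ac)
        then have "ennreal (y powr \<alpha>\<^sub>1 * (1 + y) ^ m * exp (- y) * \<bar>x - y\<bar> powr \<alpha>) \<le>
          ennreal (y powr c * v y + (v y + K * exp 1 * k (x - y)))" by (rule ennreal_leI)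
        also have "\<dots> = ennreal (y powr c * v y) + (ennreal (v y) + ennreal (K * exp 1) * ennreal (k (x - y)))"
          using K v by (simp add: ennreal_plus ennreal_mult k_def)
        finally show ?thesis using y by (simp add: v_def mult.assoc)
      qed simp
    qed
    also have "\<dots> = J1 + (J2 + ennreal (K * exp 1) * (\<integral>\<^sup>+y. ennreal (k (x - y)) \<partial>lborel))"
      unfolding J1_def J2_def by (subst nn_integral_add, simp, simp)+ (simp add: nn_integral_cmult)
    also have "(\<integral>\<^sup>+y. ennreal (k (x - y)) \<partial>lborel) = J3"
      unfolding J3_def by (subst (2) nn_integral_real_affine[where c = "-1" and t = x]) auto
    also have "J1 + (J2 + ennreal (K * exp 1) * J3) = ennreal (enn2real C * (1 + x) ^ 0)"
      using C by (simp add: C_def)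
    finally show "(\<integral>\<^sup>+y. ennreal (y powr \<alpha>\<^sub>1 * (1 + y) ^ m * exp (- y) * \<bar>x - y\<bar> powr \<alpha>) * indicator {0<..} y \<partial>lborel)
      \<le> ennreal (enn2real C * (1 + x) ^ 0)" .
  qed simp
qed

section \<open>Products and sums over pairs of eigenvalues, and the comparison with stars\<close>

lemma prod_off_diagonal_symmetric:
  fixes f :: "nat \<Rightarrow> nat \<Rightarrow> 'a :: comm_monoid_mult"
  assumes sym: "\<And>i j. f i j = f j i"
  shows "(\<Prod>i<N. \<Prod>j\<in>{..<N} - {i}. f i j) = (\<Prod>k<N. \<Prod>j<k. f k j)\<^sup>2"
proof (induction N)
  case (Suc N)
  have "(\<Prod>j\<in>{..<Suc N} - {i}. f i j) = f N i * (\<Prod>j\<in>{..<N} - {i}. f i j)" if "i < N" for i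
  proof -
    have "{..<Suc N} - {i} = insert N ({..<N} - {i})" using that by auto
    then show ?thesis by (simp add: sym[of i N])
  qed
  moreover have "{..<Suc N} - {N} = {..<N}" by auto
  ultimately show ?case
    by (simp add: Suc prod.distrib power2_eq_square mult_ac)
qed simp

lemma sum_symmetric:
  fixes f :: "nat \<Rightarrow> nat \<Rightarrow> 'a :: comm_semiring_1"
  assumes sym: "\<And>i j. f i j = f j i"
  shows "(\<Sum>i<N. \<Sum>j<N. f i j) = 2 * (\<Sum>k<N. \<Sum>j<k. f k j) + (\<Sum>i<N. f i i)"
proof (induction N)
  case (Suc N)
  have "(\<Sum>i<N. f i N) = (\<Sum>i<N. f N i)" by (simp add: sym)
  then show ?case by (simp add: Suc sum.distrib algebra_simps mult_2)
qed simp

text \<open>A crude form of the inequality of arithmetic and geometric means: the product is at most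
  the N-th power of the largest factor, which is one of the summands.\<close>

lemma prod_le_sum_power:
  fixes a :: "nat \<Rightarrow> real"
  assumes "N > 0" "\<And>i. i < N \<Longrightarrow> 0 \<le> a i"
  shows "(\<Prod>i<N. a i) \<le> (\<Sum>i<N. a i ^ N)"
proof -
  have "Max (a ` {..<N}) \<in> a ` {..<N}" using assms by (intro Max_in) auto
  then obtain i where i: "i < N" "a i = Max (a ` {..<N})" by auto
  have "(\<Prod>j<N. a j) \<le> (\<Prod>j<N. a i)"
    by (rule prod_mono) (use assms i in auto)
  also have "\<dots> = a i ^ N" by simp
  also have "\<dots> \<le> (\<Sum>i<N. a i ^ N)"
    by (rule member_le_sum[where f = "\<lambda>i. a i ^ N"]) (use assms i in auto)
  finally show ?thesis .
qed

text \<open>Averaging over the \<open>N\<close> star trees of the complete graph: each edge lies in two of them, so the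
  exponent \<open>2 * \<alpha> / N\<close> turns into \<open>\<alpha>\<close>, and on a star the integral factorizes. This is what reaches
  the sharp range of negative \<open>\<alpha>\<close>.\<close>

lemma prod_pairs_le_sum_stars:
  fixes x :: "nat \<Rightarrow> real"
  assumes "N > 0"
  shows "(\<Prod>k<N. \<Prod>j<k. \<bar>x k - x j\<bar> powr (2 * \<alpha> / real N)) \<le>
    (\<Sum>i<N. \<Prod>j\<in>{..<N} - {i}. \<bar>x i - x j\<bar> powr \<alpha>)"
proof -
  \<comment> \<open>The N-th power of \<open>a i\<close> is the star with centre i and exponent
    \<alpha>, while in the product over i each unordered pair occurs twice and receives the exponent
    2 \<alpha> / N.\<close>
  define a where "a i = (\<Prod>j\<in>{..<N} - {i}. \<bar>x i - x j\<bar> powr (\<alpha> / real N))" for i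
  have "(\<Prod>i<N. a i) = (\<Prod>k<N. \<Prod>j<k. \<bar>x k - x j\<bar> powr (\<alpha> / real N))\<^sup>2"
    unfolding a_def by (rule prod_off_diagonal_symmetric) (simp add: abs_minus_commute)
  also have "\<dots> = (\<Prod>k<N. \<Prod>j<k. \<bar>x k - x j\<bar> powr (2 * \<alpha> / real N))"
    by (simp add: power2_eq_square flip: prod.distrib powr_add)
  finally have "(\<Prod>k<N. \<Prod>j<k. \<bar>x k - x j\<bar> powr (2 * \<alpha> / real N)) \<le> (\<Sum>i<N. a i ^ N)"
    using prod_le_sum_power[of N a] assms by (simp add: a_def prod_nonneg)
  moreover have "a i ^ N = (\<Prod>j\<in>{..<N} - {i}. \<bar>x i - x j\<bar> powr \<alpha>)" for i
  proof -
    have "(z powr (\<alpha> / real N)) ^ N = z powr \<alpha>" if "z \<ge> 0" for z :: real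
      using assms that by (cases "z = 0") (auto simp: powr_powr simp flip: powr_realpow)
    then show ?thesis by (simp add: a_def prod_power_distrib)
  qed
  ultimately show ?thesis by simp
qed

lemma measurable_laguerre_weight [measurable]:
  "laguerre_weight \<alpha>\<^sub>1 \<beta> N \<in> borel_measurable (PiM {..<N} (\<lambda>_. lborel))"
proof -
  have [measurable]: "(\<lambda>x. x l) \<in> borel_measurable (PiM {..<N} (\<lambda>_. lborel :: real measure))" if "l < N" for l
    using measurable_component_singleton[of l "{..<N}" "\<lambda>_. lborel :: real measure"] that by simp
  have [measurable]: "Measurable.pred (PiM {..<N} (\<lambda>_. lborel)) (\<lambda>x. \<forall>l<N. 0 < (x l :: real))"
  proof -
    have "Measurable.pred (PiM {..<N} (\<lambda>_. lborel)) (\<lambda>x. \<forall>l\<in>{..<N}. 0 < (x l :: real))"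
      by (rule pred_intros_finite) auto
    then show ?thesis by (simp add: Ball_def)
  qed
  show ?thesis unfolding laguerre_weight_def[abs_def]
    by (intro measurable_If borel_measurable_times borel_measurable_prod) auto
qed

lemma laguerre_weight_nonneg: "laguerre_weight \<alpha>\<^sub>1 \<beta> N x \<ge> 0"
  by (auto simp: laguerre_weight_def intro!: mult_nonneg_nonneg prod_nonneg)

text \<open>For a fixed centre the leaves are independent, so their integral is a product of
  one-dimensional ones. Each grows at most polynomially in the centre, and the exponential in the
  centre variable absorbs that growth.\<close>

lemma nn_integral_laguerre_star_finite:
  fixes \<alpha> \<alpha>\<^sub>1 :: real and I :: "'i set" and m :: nat
  assumes "\<alpha>\<^sub>1 > - 1" "\<alpha> > - min 1 (1 + \<alpha>\<^sub>1)" "finite I" "i \<in> I"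
  defines "q \<equiv> \<lambda>y. y powr \<alpha>\<^sub>1 * (1 + y) ^ m * exp (- y)"
  shows "(\<integral>\<^sup>+x. ennreal (q (x i)) * indicator {0<..} (x i) *
      (\<Prod>j\<in>I - {i}. ennreal (q (x j) * \<bar>x i - x j\<bar> powr \<alpha>) * indicator {0<..} (x j))
      \<partial>PiM I (\<lambda>_. lborel)) < \<infinity>" (is "integral\<^sup>N _ ?F < \<infinity>")
proof -
  interpret product_sigma_finite "\<lambda>_::'i. lborel :: real measure" ..
  have [measurable]: "q \<in> borel_measurable borel" unfolding q_def by measurable
  have F: "?F \<in> borel_measurable (PiM (insert i (I - {i})) (\<lambda>_. lborel))"
  proof -
    have [measurable]: "(\<lambda>x. x l) \<in> borel_measurable (PiM I (\<lambda>_. lborel :: real measure))" if "l \<in> I" for l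
      using measurable_component_singleton[of l I "\<lambda>_. lborel :: real measure"] that by simp
    show ?thesis using \<open>i \<in> I\<close> by (simp add: insert_absorb) measurable
  qed
  obtain C M where C: "C \<ge> 0" and h: "\<And>x. x > 0 \<Longrightarrow>
    (\<integral>\<^sup>+y. ennreal (q y * \<bar>x - y\<bar> powr \<alpha>) * indicator {0<..} y \<partial>lborel) \<le> ennreal (C * (1 + x) ^ M)"
    using nn_integral_laguerre_factor_bound[OF assms(1,2), of m] unfolding q_def by blast
  define n where "n = card (I - {i})"
  have "integral\<^sup>N (PiM (insert i (I - {i})) (\<lambda>_. lborel)) ?F =
    (\<integral>\<^sup>+y. \<integral>\<^sup>+x. ?F (x(i := y)) \<partial>PiM (I - {i}) (\<lambda>_. lborel) \<partial>lborel)"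
    by (rule product_nn_integral_insert_rev) (use F \<open>finite I\<close> in auto)
  also have "\<dots> = (\<integral>\<^sup>+y. \<integral>\<^sup>+x. ennreal (q y) * indicator {0<..} y *
      (\<Prod>j\<in>I - {i}. ennreal (q (x j) * \<bar>y - x j\<bar> powr \<alpha>) * indicator {0<..} (x j))
      \<partial>PiM (I - {i}) (\<lambda>_. lborel) \<partial>lborel)"
    by (intro nn_integral_cong arg_cong2[where f = "(*)"] prod.cong) auto
  also have "\<dots> = (\<integral>\<^sup>+y. ennreal (q y) * indicator {0<..} y *
      (\<Prod>j\<in>I - {i}. \<integral>\<^sup>+t. ennreal (q t * \<bar>y - t\<bar> powr \<alpha>) * indicator {0<..} t \<partial>lborel) \<partial>lborel)"
  proof (rule nn_integral_cong)
    fix y :: real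
    have "(\<integral>\<^sup>+x. ennreal (q y) * indicator {0<..} y *
      (\<Prod>j\<in>I - {i}. ennreal (q (x j) * \<bar>y - x j\<bar> powr \<alpha>) * indicator {0<..} (x j))
      \<partial>PiM (I - {i}) (\<lambda>_. lborel)) = ennreal (q y) * indicator {0<..} y * (\<integral>\<^sup>+x.
      (\<Prod>j\<in>I - {i}. ennreal (q (x j) * \<bar>y - x j\<bar> powr \<alpha>) * indicator {0<..} (x j))
      \<partial>PiM (I - {i}) (\<lambda>_. lborel))"
    proof (rule nn_integral_cmult)
      have [measurable]: "(\<lambda>x. x l) \<in> borel_measurable (PiM (I - {i}) (\<lambda>_. lborel :: real measure))" if "l \<in> I - {i}" for l
        using measurable_component_singleton[of l "I - {i}" "\<lambda>_. lborel :: real measure"] that by simp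
      show "(\<lambda>x. \<Prod>j\<in>I - {i}. ennreal (q (x j) * \<bar>y - x j\<bar> powr \<alpha>) * indicator {0<..} (x j))
        \<in> borel_measurable (PiM (I - {i}) (\<lambda>_. lborel))" by measurable
    qed
    also have "(\<integral>\<^sup>+x. (\<Prod>j\<in>I - {i}. ennreal (q (x j) * \<bar>y - x j\<bar> powr \<alpha>) * indicator {0<..} (x j))
      \<partial>PiM (I - {i}) (\<lambda>_. lborel)) =
      (\<Prod>j\<in>I - {i}. \<integral>\<^sup>+t. ennreal (q t * \<bar>y - t\<bar> powr \<alpha>) * indicator {0<..} t \<partial>lborel)"
      by (rule product_nn_integral_prod[where f = "\<lambda>j t. ennreal (q t * \<bar>y - t\<bar> powr \<alpha>) * indicator {0<..} t"])
        (use \<open>finite I\<close> in auto)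
    finally show "(\<integral>\<^sup>+x. ennreal (q y) * indicator {0<..} y *
      (\<Prod>j\<in>I - {i}. ennreal (q (x j) * \<bar>y - x j\<bar> powr \<alpha>) * indicator {0<..} (x j))
      \<partial>PiM (I - {i}) (\<lambda>_. lborel)) = ennreal (q y) * indicator {0<..} y *
      (\<Prod>j\<in>I - {i}. \<integral>\<^sup>+t. ennreal (q t * \<bar>y - t\<bar> powr \<alpha>) * indicator {0<..} t \<partial>lborel)" .
  qed
  \<comment> \<open>The \<open>n\<close> leaves contribute the \<open>n\<close>-th power of the
    factor bound, which only raises the power of 1 + y from \<open>m\<close> to
    \<open>m + M * n\<close>.\<close>
  also have "\<dots> \<le> (\<integral>\<^sup>+y. ennreal (C ^ n) * (ennreal (y powr \<alpha>\<^sub>1 * (1 + y) ^ (m + M * n) * exp (- y)) * indicator {0<..} y) \<partial>lborel)"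
  proof (rule nn_integral_mono)
    fix y :: real
    show "ennreal (q y) * indicator {0<..} y *
      (\<Prod>j\<in>I - {i}. \<integral>\<^sup>+t. ennreal (q t * \<bar>y - t\<bar> powr \<alpha>) * indicator {0<..} t \<partial>lborel)
      \<le> ennreal (C ^ n) * (ennreal (y powr \<alpha>\<^sub>1 * (1 + y) ^ (m + M * n) * exp (- y)) * indicator {0<..} y)"
    proof (cases "y > 0")
      case True
      have "(\<Prod>j\<in>I - {i}. \<integral>\<^sup>+t. ennreal (q t * \<bar>y - t\<bar> powr \<alpha>) * indicator {0<..} t \<partial>lborel)
        \<le> (\<Prod>j\<in>I - {i}. ennreal (C * (1 + y) ^ M))"
        by (rule prod_mono_ennreal) (use h[OF True] in auto)
      also have "\<dots> = ennreal ((C * (1 + y) ^ M) ^ n)"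
        using C True by (simp add: n_def ennreal_power)
      finally have "ennreal (q y) * (\<Prod>j\<in>I - {i}. \<integral>\<^sup>+t. ennreal (q t * \<bar>y - t\<bar> powr \<alpha>) * indicator {0<..} t \<partial>lborel)
        \<le> ennreal (q y) * ennreal ((C * (1 + y) ^ M) ^ n)"
        by (rule mult_left_mono) auto
      also have "\<dots> = ennreal (q y * (C * (1 + y) ^ M) ^ n)"
        using True by (simp add: q_def ennreal_mult')
      also have "q y * (C * (1 + y) ^ M) ^ n = C ^ n * (y powr \<alpha>\<^sub>1 * (1 + y) ^ (m + M * n) * exp (- y))"
        by (simp add: q_def power_add power_mult_distrib power_mult)
      finally show ?thesis using True C by (simp add: ennreal_mult')
    qed simp
  qed
  also have "\<dots> = ennreal (C ^ n) * (\<integral>\<^sup>+y. ennreal (y powr \<alpha>\<^sub>1 * (1 + y) ^ (m + M * n) * exp (- y)) * indicator {0<..} y \<partial>lborel)"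
    by (rule nn_integral_cmult) measurable
  also have "\<dots> < \<infinity>"
    using nn_integral_powr_exp_finite[OF assms(1)] by (simp add: ennreal_mult_less_top)
  finally show ?thesis using \<open>i \<in> I\<close> by (simp add: insert_absorb)
qed

text \<open>On the positive orthant the powers of the product of all 1 + x_l dominate every
  polynomial in the coordinates, and they factorize over coordinates, so they merge into the
  one-variable factor \<open>q\<close> of the star integrals.\<close>

lemma integrable_laguerre_weight:
  fixes \<alpha> \<alpha>\<^sub>1 :: real
  assumes "\<alpha>\<^sub>1 > - 1" "\<alpha> > - min 1 (1 + \<alpha>\<^sub>1)" "N > 0"
  shows "integrable (PiM {..<N} (\<lambda>_. lborel))
    (\<lambda>x. (\<Prod>l<N. 1 + x l) ^ m * laguerre_weight \<alpha>\<^sub>1 (2 * \<alpha> / real N) N x)"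
proof (rule integrableI_bounded)
  let ?L = "PiM {..<N} (\<lambda>_. lborel :: real measure)"
  have comp [measurable]: "(\<lambda>x. x l) \<in> borel_measurable ?L" if "l \<in> {..<N}" for l
    using measurable_component_singleton[of l "{..<N}" "\<lambda>_. lborel :: real measure"] that by simp
  show "(\<lambda>x. (\<Prod>l<N. 1 + x l) ^ m * laguerre_weight \<alpha>\<^sub>1 (2 * \<alpha> / real N) N x) \<in> borel_measurable ?L"
    by measurable
  define q where "q y = y powr \<alpha>\<^sub>1 * (1 + y) ^ m * exp (- y)" for y :: real
  have [measurable]: "q \<in> borel_measurable borel" unfolding q_def by measurable
  define F where "F i x = ennreal (q (x i)) * indicator {0<..} (x i) *
      (\<Prod>j\<in>{..<N} - {i}. ennreal (q (x j) * \<bar>x i - x j\<bar> powr \<alpha>) * indicator {0<..} (x j))" for i and x :: "nat \<Rightarrow> real"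
  have F_meas: "F i \<in> borel_measurable ?L" if "i \<in> {..<N}" for i
    using that unfolding F_def by measurable
  have "(\<integral>\<^sup>+x. ennreal (norm ((\<Prod>l<N. 1 + x l) ^ m * laguerre_weight \<alpha>\<^sub>1 (2 * \<alpha> / real N) N x)) \<partial>?L)
    \<le> (\<integral>\<^sup>+x. (\<Sum>i<N. F i x) \<partial>?L)"
  proof (rule nn_integral_mono)
    fix x :: "nat \<Rightarrow> real"
    show "ennreal (norm ((\<Prod>l<N. 1 + x l) ^ m * laguerre_weight \<alpha>\<^sub>1 (2 * \<alpha> / real N) N x)) \<le> (\<Sum>i<N. F i x)"
    proof (cases "\<forall>l<N. 0 < x l")
      case True
      then have q0: "q (x l) \<ge> 0" if "l < N" for l using that by (simp add: q_def less_imp_le)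
      have F: "F i x = ennreal ((\<Prod>l<N. q (x l)) * (\<Prod>j\<in>{..<N} - {i}. \<bar>x i - x j\<bar> powr \<alpha>))" if "i < N" for i
      proof -
        have "F i x = ennreal (q (x i)) * (\<Prod>j\<in>{..<N} - {i}. ennreal (q (x j) * \<bar>x i - x j\<bar> powr \<alpha>))"
          using True that by (simp add: F_def)
        also have "\<dots> = ennreal (q (x i) * (\<Prod>j\<in>{..<N} - {i}. q (x j) * \<bar>x i - x j\<bar> powr \<alpha>))"
          using q0 that by (subst prod_ennreal) (auto simp: ennreal_mult')
        also have "q (x i) * (\<Prod>j\<in>{..<N} - {i}. q (x j) * \<bar>x i - x j\<bar> powr \<alpha>) =
          (\<Prod>l<N. q (x l)) * (\<Prod>j\<in>{..<N} - {i}. \<bar>x i - x j\<bar> powr \<alpha>)"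
          using that by (simp add: prod.distrib prod.remove[of "{..<N}" i])
        finally show ?thesis .
      qed
      have "(\<Prod>l<N. 1 + x l) ^ m * laguerre_weight \<alpha>\<^sub>1 (2 * \<alpha> / real N) N x =
        (\<Prod>l<N. q (x l)) * (\<Prod>k<N. \<Prod>j<k. \<bar>x k - x j\<bar> powr (2 * \<alpha> / real N))"
        using True by (simp add: laguerre_weight_def q_def prod.distrib prod_power_distrib mult_ac)
      also have "\<dots> \<le> (\<Prod>l<N. q (x l)) * (\<Sum>i<N. \<Prod>j\<in>{..<N} - {i}. \<bar>x i - x j\<bar> powr \<alpha>)"
        using prod_pairs_le_sum_stars[OF \<open>N > 0\<close>] q0 by (intro mult_left_mono prod_nonneg) auto
      also have "\<dots> = (\<Sum>i<N. (\<Prod>l<N. q (x l)) * (\<Prod>j\<in>{..<N} - {i}. \<bar>x i - x j\<bar> powr \<alpha>))"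
        by (simp add: sum_distrib_left)
      finally have le: "(\<Prod>l<N. 1 + x l) ^ m * laguerre_weight \<alpha>\<^sub>1 (2 * \<alpha> / real N) N x \<le> \<dots>" .
      have "0 \<le> (\<Prod>l<N. 1 + x l) ^ m * laguerre_weight \<alpha>\<^sub>1 (2 * \<alpha> / real N) N x"
        using True by (intro mult_nonneg_nonneg zero_le_power prod_nonneg laguerre_weight_nonneg) (auto simp: less_imp_le add_nonneg_nonneg)
      then have "ennreal (norm ((\<Prod>l<N. 1 + x l) ^ m * laguerre_weight \<alpha>\<^sub>1 (2 * \<alpha> / real N) N x)) \<le>
         ennreal (\<Sum>i<N. (\<Prod>l<N. q (x l)) * (\<Prod>j\<in>{..<N} - {i}. \<bar>x i - x j\<bar> powr \<alpha>))"
        using le by (intro ennreal_leI) simp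
      also have "\<dots> = (\<Sum>i<N. F i x)"
        using F q0 by (subst sum_ennreal[symmetric]) (auto intro!: mult_nonneg_nonneg prod_nonneg)
      finally show ?thesis .
    qed (auto simp: laguerre_weight_def)
  qed
  also have "\<dots> = (\<Sum>i<N. integral\<^sup>N ?L (F i))"
    by (rule nn_integral_sum) (use F_meas in auto)
  also have "\<dots> < \<infinity>"
    using nn_integral_laguerre_star_finite[OF assms(1,2), of "{..<N}"]
    by (auto simp: F_def[abs_def] q_def[abs_def])
  finally show "(\<integral>\<^sup>+x. ennreal (norm ((\<Prod>l<N. 1 + x l) ^ m * laguerre_weight \<alpha>\<^sub>1 (2 * \<alpha> / real N) N x)) \<partial>?L) < \<infinity>" .
qed

text \<open>The ensemble divides by this integral; were it 0, division by zero would make the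
  density identically 0.\<close>

lemma integral_laguerre_weight_pos:
  fixes \<alpha> \<alpha>\<^sub>1 :: real
  assumes "\<alpha>\<^sub>1 > - 1" "\<alpha> > - min 1 (1 + \<alpha>\<^sub>1)" "N > 0"
  shows "integral\<^sup>L (PiM {..<N} (\<lambda>_. lborel)) (laguerre_weight \<alpha>\<^sub>1 (2 * \<alpha> / real N) N) > 0"
proof -
  interpret product_sigma_finite "\<lambda>_::nat. lborel :: real measure" ..
  let ?L = "PiM {..<N} (\<lambda>_. lborel :: real measure)"
  let ?w = "laguerre_weight \<alpha>\<^sub>1 (2 * \<alpha> / real N) N"
  have int: "integrable ?L ?w" using integrable_laguerre_weight[OF assms, of 0] by simp
  have "integral\<^sup>L ?L ?w \<noteq> 0"
  proof
    assume "integral\<^sup>L ?L ?w = 0"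
    then have ae: "AE x in ?L. ?w x = 0"
      using integral_nonneg_eq_0_iff_AE[OF int] by (simp add: laguerre_weight_nonneg)
    \<comment> \<open>A unit cube with its coordinates in disjoint intervals: they are positive and
      pairwise distinct there. Distinctness matters even for \<beta> = 0, as
      \<open>0 powr 0 = 0\<close>.\<close>
    define A where "A = (\<Pi>\<^sub>E l\<in>{..<N}. {real l<..<real l + 1})"
    have A: "A \<in> sets ?L" unfolding A_def by (rule sets_PiM_I_finite) auto
    have "?w x \<noteq> 0" if "x \<in> A" for x
    proof -
      have x: "real l < x l \<and> x l < real l + 1" if "l < N" for l
        using \<open>x \<in> A\<close> that by (auto simp: A_def PiE_def Pi_def)
      have "0 < x l" "x l \<noteq> 0" if "l < N" for l using x[OF that] by linarith+
      moreover have "x k \<noteq> x j" if "k < N" "j < k" for j k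
        using x[of k] x[of j] that by force
      ultimately show ?thesis by (auto simp: laguerre_weight_def)
    qed
    with ae have "AE x in ?L. x \<notin> A" by (elim eventually_mono) auto
    then have "emeasure ?L A = 0"
      using AE_iff_measurable[OF A, of "\<lambda>x. x \<notin> A"] sets.sets_into_space[OF A] by auto
    moreover have "emeasure ?L A = 1"
      unfolding A_def by (subst emeasure_PiM) auto
    ultimately show False by simp
  qed
  moreover have "integral\<^sup>L ?L ?w \<ge> 0" by (simp add: laguerre_weight_nonneg)
  ultimately show ?thesis by linarith
qed

section \<open>The logarithmic ratio under the flow\<close>

text \<open>The divided difference of t^(p+1), that is, the complete homogeneous symmetric
  polynomial of degree p in two variables. As a sum it has no singularity on the diagonal, where it
  equals (p + 1) u^p.\<close>

definition divided_power :: "nat \<Rightarrow> real \<Rightarrow> real \<Rightarrow> real" where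
  "divided_power p u v = (\<Sum>s\<le>p. u ^ s * v ^ (p - s))"

lemma power_Suc_diff_divided_power: "u ^ Suc p - v ^ Suc p = (u - v) * divided_power p u v"
  by (simp only: diff_power_eq_sum divided_power_def lessThan_Suc_atMost)

lemma divided_power_commute: "divided_power p u v = divided_power p v u"
  unfolding divided_power_def
  by (rule sum.reindex_bij_witness[of _ "\<lambda>s. p - s" "\<lambda>s. p - s"]) auto

lemma divided_power_nonneg: "0 \<le> u \<Longrightarrow> 0 \<le> v \<Longrightarrow> 0 \<le> divided_power p u v"
  unfolding divided_power_def by (intro sum_nonneg) auto

lemma divided_power_le:
  assumes "0 \<le> u" "u \<le> b" "0 \<le> v" "v \<le> b"
  shows "divided_power p u v \<le> real (p + 1) * b ^ p"
proof -
  have "divided_power p u v \<le> (\<Sum>s\<le>p. b ^ p)"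
    unfolding divided_power_def
  proof (rule sum_mono)
    fix s assume "s \<in> {..p}"
    have "u ^ s * v ^ (p - s) \<le> b ^ s * b ^ (p - s)"
      using assms by (intro mult_mono power_mono) auto
    also have "\<dots> = b ^ p" using \<open>s \<in> {..p}\<close> by (simp flip: power_add)
    finally show "u ^ s * v ^ (p - s) \<le> b ^ p" .
  qed
  then show ?thesis by simp
qed

text \<open>Logarithm of the factor by which weight times Jacobian changes under
  \<open>x \<mapsto> x + \<epsilon> * x ^ (p + 1)\<close> in every coordinate. The singular factors of the weight
  cancel, so it is smooth in \<open>\<epsilon>\<close> even for negative exponents.\<close>

definition laguerre_log_ratio :: "real \<Rightarrow> real \<Rightarrow> nat \<Rightarrow> nat \<Rightarrow> real \<Rightarrow> (nat \<Rightarrow> real) \<Rightarrow> real" where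
  "laguerre_log_ratio \<alpha>\<^sub>1 \<beta> N p \<epsilon> x =
     (\<Sum>l<N. \<alpha>\<^sub>1 * ln (1 + \<epsilon> * x l ^ p) + ln (1 + \<epsilon> * (real (p + 1) * x l ^ p)) - \<epsilon> * x l ^ (p + 1))
     + \<beta> * (\<Sum>k<N. \<Sum>j<k. ln (1 + \<epsilon> * divided_power p (x k) (x j)))"

text \<open>The divergence of the weight times the vector field with components x_l^(p+1), divided
  by the weight: \<open>\<alpha>\<^sub>1\<close>, the exponential and \<beta> come from the
  logarithmic derivative of the weight, and p + 1 from the field itself.\<close>

definition laguerre_log_ratio_deriv :: "real \<Rightarrow> real \<Rightarrow> nat \<Rightarrow> nat \<Rightarrow> (nat \<Rightarrow> real) \<Rightarrow> real" where
  "laguerre_log_ratio_deriv \<alpha>\<^sub>1 \<beta> N p x =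
     (\<Sum>l<N. \<alpha>\<^sub>1 * x l ^ p + real (p + 1) * x l ^ p - x l ^ (p + 1))
     + \<beta> * (\<Sum>k<N. \<Sum>j<k. divided_power p (x k) (x j))"

text \<open>Each coordinate and each difference of coordinates is multiplied by a positive factor, 1
  + \<epsilon> x_l^p and 1 + \<epsilon> \<open>divided_power p (x k) (x j)\<close> respectively, so
  \<open>powr\<close> splits. Where coordinates coincide both sides are 0.\<close>

lemma laguerre_weight_substitution:
  assumes "\<epsilon> \<ge> 0" and pos: "\<And>l. l < N \<Longrightarrow> 0 < x l"
  shows "laguerre_weight \<alpha>\<^sub>1 \<beta> N (\<lambda>l\<in>{..<N}. x l + \<epsilon> * x l ^ (p + 1)) *
      (\<Prod>l<N. 1 + \<epsilon> * (real (p + 1) * x l ^ p)) =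
    laguerre_weight \<alpha>\<^sub>1 \<beta> N x * exp (laguerre_log_ratio \<alpha>\<^sub>1 \<beta> N p \<epsilon> x)"
proof -
  let ?g = "\<lambda>y. y + \<epsilon> * y ^ (p + 1)"
  have gpos: "0 < ?g (x l)" if "l < N" for l
    using pos[OF that] assms by (simp add: add_pos_nonneg)
  have 1: "1 + \<epsilon> * t > 0" if "t \<ge> 0" for t using assms that by (simp add: add_pos_nonneg)
  have single: "?g (x l) powr \<alpha>\<^sub>1 * exp (- ?g (x l)) * (1 + \<epsilon> * (real (p + 1) * x l ^ p)) =
      x l powr \<alpha>\<^sub>1 * exp (- x l) *
      exp (\<alpha>\<^sub>1 * ln (1 + \<epsilon> * x l ^ p) + ln (1 + \<epsilon> * (real (p + 1) * x l ^ p)) - \<epsilon> * x l ^ (p + 1))"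
    if "l < N" for l
  proof -
    have p0: "0 \<le> x l ^ p" "0 \<le> real (p + 1) * x l ^ p" using pos[OF that] by (auto simp: less_imp_le)
    have "?g (x l) = x l * (1 + \<epsilon> * x l ^ p)" by (simp add: algebra_simps)
    then have "?g (x l) powr \<alpha>\<^sub>1 = x l powr \<alpha>\<^sub>1 * exp (\<alpha>\<^sub>1 * ln (1 + \<epsilon> * x l ^ p))"
      using pos[OF that] 1[OF p0(1)] by (simp only: powr_mult) (simp add: powr_def)
    moreover have "exp (ln (1 + \<epsilon> * (real (p + 1) * x l ^ p))) = 1 + \<epsilon> * (real (p + 1) * x l ^ p)"
      using 1[OF p0(2)] by simp
    moreover have "exp (- ?g (x l)) = exp (- x l) * exp (- (\<epsilon> * x l ^ (p + 1)))"
      by (simp flip: exp_add)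
    ultimately show ?thesis by (simp add: exp_add exp_diff exp_minus field_simps)
  qed
  have pair: "\<bar>?g (x k) - ?g (x j)\<bar> powr \<beta> = \<bar>x k - x j\<bar> powr \<beta> *
      exp (\<beta> * ln (1 + \<epsilon> * divided_power p (x k) (x j)))" if "k < N" "j < k" for k j
  proof -
    have d: "1 + \<epsilon> * divided_power p (x k) (x j) > 0"
      using that pos[of k] pos[of j] by (intro 1 divided_power_nonneg) auto
    have "?g (x k) - ?g (x j) = (x k - x j) * (1 + \<epsilon> * divided_power p (x k) (x j))"
      using arg_cong[OF power_Suc_diff_divided_power[of "x k" p "x j"], of "\<lambda>t. \<epsilon> * t"]
      by (simp add: algebra_simps)
    then have "\<bar>?g (x k) - ?g (x j)\<bar> = \<bar>x k - x j\<bar> * (1 + \<epsilon> * divided_power p (x k) (x j))"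
      using d by (simp only: abs_mult)
    then show ?thesis using d by (simp only: powr_mult) (simp add: powr_def)
  qed
  have "laguerre_weight \<alpha>\<^sub>1 \<beta> N (\<lambda>l\<in>{..<N}. ?g (x l)) =
      (\<Prod>l<N. ?g (x l) powr \<alpha>\<^sub>1 * exp (- ?g (x l))) * (\<Prod>k<N. \<Prod>j<k. \<bar>?g (x k) - ?g (x j)\<bar> powr \<beta>)"
    using gpos by (auto simp: laguerre_weight_def intro!: arg_cong2[where f = "(*)"] prod.cong)
  then have "laguerre_weight \<alpha>\<^sub>1 \<beta> N (\<lambda>l\<in>{..<N}. ?g (x l)) * (\<Prod>l<N. 1 + \<epsilon> * (real (p + 1) * x l ^ p)) =
      (\<Prod>l<N. ?g (x l) powr \<alpha>\<^sub>1 * exp (- ?g (x l)) * (1 + \<epsilon> * (real (p + 1) * x l ^ p))) *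
      (\<Prod>k<N. \<Prod>j<k. \<bar>?g (x k) - ?g (x j)\<bar> powr \<beta>)"
    by (simp only: prod.distrib mult_ac)
  also have "\<dots> = (\<Prod>l<N. x l powr \<alpha>\<^sub>1 * exp (- x l) *
      exp (\<alpha>\<^sub>1 * ln (1 + \<epsilon> * x l ^ p) + ln (1 + \<epsilon> * (real (p + 1) * x l ^ p)) - \<epsilon> * x l ^ (p + 1))) *
      (\<Prod>k<N. \<Prod>j<k. \<bar>x k - x j\<bar> powr \<beta> * exp (\<beta> * ln (1 + \<epsilon> * divided_power p (x k) (x j))))"
  proof (rule arg_cong2[where f = "(*)"])
    show "(\<Prod>k<N. \<Prod>j<k. \<bar>?g (x k) - ?g (x j)\<bar> powr \<beta>) =
      (\<Prod>k<N. \<Prod>j<k. \<bar>x k - x j\<bar> powr \<beta> * exp (\<beta> * ln (1 + \<epsilon> * divided_power p (x k) (x j))))"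
      by (rule prod.cong[OF refl], rule prod.cong[OF refl], rule pair) auto
  qed (rule prod.cong[OF refl], rule single, simp)
  also have "\<dots> = laguerre_weight \<alpha>\<^sub>1 \<beta> N x * exp (laguerre_log_ratio \<alpha>\<^sub>1 \<beta> N p \<epsilon> x)"
    using pos by (simp add: laguerre_weight_def laguerre_log_ratio_def exp_add exp_sum
        sum_distrib_left prod.distrib mult_ac)
  finally show ?thesis by simp
qed

lemma measurable_laguerre_log_ratio [measurable]:
  "laguerre_log_ratio \<alpha>\<^sub>1 \<beta> N p \<epsilon> \<in> borel_measurable (PiM {..<N} (\<lambda>_. lborel))"
proof -
  have comp: "(\<lambda>x. x l) \<in> borel_measurable (PiM {..<N} (\<lambda>_. lborel :: real measure))" if "l < N" for l
    using measurable_component_singleton[of l "{..<N}" "\<lambda>_. lborel :: real measure"] that by simp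
  show ?thesis
    unfolding laguerre_log_ratio_def[abs_def] divided_power_def
    by (intro borel_measurable_add borel_measurable_diff borel_measurable_times borel_measurable_sum
        borel_measurable_ln borel_measurable_const borel_measurable_power comp) auto
qed

text \<open>An identity in [0, \<infinity>], valid for every \<beta>, integrable weight or not; when
  the weight is integrable, its product with the ratio inherits this.\<close>

lemma nn_integral_laguerre_weight_ratio:
  assumes "\<epsilon> \<ge> 0"
  shows "(\<integral>\<^sup>+x. ennreal (laguerre_weight \<alpha>\<^sub>1 \<beta> N x * exp (laguerre_log_ratio \<alpha>\<^sub>1 \<beta> N p \<epsilon> x)) \<partial>PiM {..<N} (\<lambda>_. lborel)) =
    (\<integral>\<^sup>+x. ennreal (laguerre_weight \<alpha>\<^sub>1 \<beta> N x) \<partial>PiM {..<N} (\<lambda>_. lborel))"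
proof -
  let ?L = "PiM {..<N} (\<lambda>_. lborel :: real measure)"
  let ?g = "\<lambda>y. y + \<epsilon> * y ^ (p + 1)" and ?g' = "\<lambda>y. 1 + \<epsilon> * (real (p + 1) * y ^ p)"
  have "(\<integral>\<^sup>+x. ennreal (laguerre_weight \<alpha>\<^sub>1 \<beta> N x) \<partial>?L) =
    (\<integral>\<^sup>+x. ennreal (laguerre_weight \<alpha>\<^sub>1 \<beta> N x) * (\<Prod>i<N. indicator {0<..} (x i)) \<partial>?L)"
    by (rule nn_integral_cong) (auto simp: laguerre_weight_def)
  also have "\<dots> = (\<integral>\<^sup>+x. ennreal (laguerre_weight \<alpha>\<^sub>1 \<beta> N (\<lambda>i\<in>{..<N}. ?g (x i))) *
      (\<Prod>i<N. ennreal (?g' (x i)) * indicator {0<..} (x i)) \<partial>?L)"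
  proof (rule nn_integral_PiM_substitution_half_line)
    show "(?g has_real_derivative ?g' x) (at x)" for x
      using DERIV_add[OF DERIV_ident DERIV_cmult[OF DERIV_pow[of "p + 1" x UNIV], of \<epsilon>]] by simp
    show "filterlim ?g at_top at_top"
    proof (rule filterlim_at_top_mono[OF filterlim_ident])
      show "eventually (\<lambda>y. y \<le> ?g y) at_top"
        using eventually_ge_at_top[of 0] by eventually_elim (use assms in simp)
    qed
  qed (use assms in \<open>auto intro!: continuous_intros add_nonneg_nonneg\<close>)
  also have "\<dots> = (\<integral>\<^sup>+x. ennreal (laguerre_weight \<alpha>\<^sub>1 \<beta> N x * exp (laguerre_log_ratio \<alpha>\<^sub>1 \<beta> N p \<epsilon> x)) \<partial>?L)"
  proof (rule nn_integral_cong)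
    fix x :: "nat \<Rightarrow> real"
    show "ennreal (laguerre_weight \<alpha>\<^sub>1 \<beta> N (\<lambda>i\<in>{..<N}. ?g (x i))) * (\<Prod>i<N. ennreal (?g' (x i)) * indicator {0<..} (x i)) =
      ennreal (laguerre_weight \<alpha>\<^sub>1 \<beta> N x * exp (laguerre_log_ratio \<alpha>\<^sub>1 \<beta> N p \<epsilon> x))"
    proof (cases "\<forall>l<N. 0 < x l")
      case True
      have g'0: "0 \<le> ?g' (x i)" if "i < N" for i
        using True assms that by (auto intro!: add_nonneg_nonneg mult_nonneg_nonneg simp: less_imp_le)
      have "(\<Prod>i<N. ennreal (?g' (x i)) * indicator {0<..} (x i)) = (\<Prod>i<N. ennreal (?g' (x i)))"
        using True by (intro prod.cong) auto
      also have "\<dots> = ennreal (\<Prod>i<N. ?g' (x i))"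
        using g'0 by (intro prod_ennreal) auto
      finally have "ennreal (laguerre_weight \<alpha>\<^sub>1 \<beta> N (\<lambda>i\<in>{..<N}. ?g (x i))) * (\<Prod>i<N. ennreal (?g' (x i)) * indicator {0<..} (x i)) =
        ennreal (laguerre_weight \<alpha>\<^sub>1 \<beta> N (\<lambda>i\<in>{..<N}. ?g (x i)) * (\<Prod>i<N. ?g' (x i)))"
        by (simp add: ennreal_mult' laguerre_weight_nonneg)
      then show ?thesis
        using laguerre_weight_substitution[OF assms, of N x \<alpha>\<^sub>1 \<beta> p] True by simp
    next
      case False
      then obtain l where l: "l < N" "\<not> 0 < x l" by blast
      then have "(\<Prod>i<N. ennreal (?g' (x i)) * indicator {0<..} (x i)) = 0"
        by (intro prod_zero) (auto intro!: bexI[of _ l])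
      moreover have "laguerre_weight \<alpha>\<^sub>1 \<beta> N x = 0" using l by (auto simp: laguerre_weight_def)
      ultimately show ?thesis by simp
    qed
  qed
  finally show ?thesis by simp
qed

lemma has_real_derivative_laguerre_log_ratio:
  "((\<lambda>\<epsilon>. laguerre_log_ratio \<alpha>\<^sub>1 \<beta> N p \<epsilon> x) has_real_derivative laguerre_log_ratio_deriv \<alpha>\<^sub>1 \<beta> N p x) (at 0)"
proof -
  have ln: "((\<lambda>\<epsilon>. ln (1 + \<epsilon> * t)) has_real_derivative t) (at 0)" for t :: real
    by (auto intro!: derivative_eq_intros)
  have lin: "((\<lambda>\<epsilon>. \<epsilon> * t) has_real_derivative t) (at 0)" for t :: real
    by (auto intro!: derivative_eq_intros)
  show ?thesis
    unfolding laguerre_log_ratio_def laguerre_log_ratio_deriv_def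
    by (intro DERIV_add DERIV_diff DERIV_cmult DERIV_sum ln lin)
qed

text \<open>These are the difference quotients at 0 along \<epsilon> = 1 / (n + 1), since the log
  ratio vanishes at \<epsilon> = 0. All these \<epsilon> are positive, where invariance of the total
  mass is available.\<close>

lemma laguerre_log_ratio_limit:
  "(\<lambda>n. (exp (laguerre_log_ratio \<alpha>\<^sub>1 \<beta> N p (inverse (real (Suc n))) x) - 1) * real (Suc n))
     \<longlonglongrightarrow> laguerre_log_ratio_deriv \<alpha>\<^sub>1 \<beta> N p x"
proof -
  let ?H = "\<lambda>\<epsilon>. laguerre_log_ratio \<alpha>\<^sub>1 \<beta> N p \<epsilon> x"
  have [simp]: "?H 0 = 0" by (simp add: laguerre_log_ratio_def)
  have "((\<lambda>\<epsilon>. exp (?H \<epsilon>)) has_real_derivative laguerre_log_ratio_deriv \<alpha>\<^sub>1 \<beta> N p x) (at 0)"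
    using DERIV_fun_exp[OF has_real_derivative_laguerre_log_ratio[of \<alpha>\<^sub>1 \<beta> N p x]] by simp
  then have "(\<lambda>h. (exp (?H h) - 1) / h) \<midarrow>0\<rightarrow> laguerre_log_ratio_deriv \<alpha>\<^sub>1 \<beta> N p x"
    by (simp add: DERIV_def)
  moreover have "filterlim (\<lambda>n. inverse (real (Suc n))) (at 0) sequentially"
    by (rule filterlim_atI[OF LIMSEQ_inverse_real_of_nat]) simp
  ultimately show ?thesis
    by (auto dest: filterlim_compose simp: divide_inverse)
qed

section \<open>Polynomial domination of the difference quotients\<close>

lemma abs_exp_minus_one_le:
  fixes h M :: real
  assumes "exp h \<le> M" "1 \<le> M"
  shows "\<bar>exp h - 1\<bar> \<le> \<bar>h\<bar> * M"
proof (cases "h \<ge> 0")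
  case True
  have "1 - h \<le> exp (- h)" using exp_ge_add_one_self[of "- h"] by simp
  then have "exp h * (1 - h) \<le> exp h * exp (- h)" by (intro mult_left_mono) auto
  then have "exp h - 1 \<le> h * exp h" by (simp add: exp_minus algebra_simps)
  also have "\<dots> \<le> h * M" using True assms by (intro mult_left_mono) auto
  finally show ?thesis using True by simp
next
  case False
  then have "exp h \<le> 1" by simp
  then have "\<bar>exp h - 1\<bar> \<le> \<bar>h\<bar> * 1" using exp_ge_add_one_self[of h] by linarith
  also have "\<dots> \<le> \<bar>h\<bar> * M" using assms by (intro mult_left_mono) auto
  finally show ?thesis .
qed

lemma one_le_prod_one_plus:
  fixes x :: "nat \<Rightarrow> real"
  assumes "\<And>l. l < N \<Longrightarrow> 0 < x l"
  shows "1 \<le> (\<Prod>l<N. 1 + x l)"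
  by (rule prod_ge_1) (use assms in \<open>auto simp: less_imp_le\<close>)

lemma le_prod_one_plus:
  fixes x :: "nat \<Rightarrow> real"
  assumes pos: "\<And>l. l < N \<Longrightarrow> 0 < x l" and "i < N"
  shows "x i \<le> (\<Prod>l<N. 1 + x l)"
proof -
  have "1 \<le> (\<Prod>l\<in>{..<N} - {i}. 1 + x l)" by (rule prod_ge_1) (use pos in \<open>auto simp: less_imp_le\<close>)
  then have "(1 + x i) * 1 \<le> (1 + x i) * (\<Prod>l\<in>{..<N} - {i}. 1 + x l)"
    using pos[OF \<open>i < N\<close>] by (intro mult_left_mono) auto
  then show ?thesis using \<open>i < N\<close> by (simp add: prod.remove[of "{..<N}" i])
qed

lemma sum_pairs_le:
  fixes f :: "nat \<Rightarrow> nat \<Rightarrow> real"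
  assumes "\<And>k j. k < N \<Longrightarrow> j < k \<Longrightarrow> f k j \<le> c" "0 \<le> c"
  shows "(\<Sum>k<N. \<Sum>j<k. f k j) \<le> real N * (real N * c)"
proof -
  have "(\<Sum>k<N. \<Sum>j<k. f k j) \<le> (\<Sum>k<N. real N * c)"
  proof (rule sum_mono)
    fix k assume k: "k \<in> {..<N}"
    have "(\<Sum>j<k. f k j) \<le> (\<Sum>j<k. c)" by (rule sum_mono) (use assms k in auto)
    also have "\<dots> = real k * c" by simp
    also have "\<dots> \<le> real N * c" using assms(2) k by (intro mult_right_mono) auto
    finally show "(\<Sum>j<k. f k j) \<le> real N * c" .
  qed
  then show ?thesis by simp
qed

text \<open>Every logarithm is bounded in two ways. By \<epsilon> T it is small, which yields the
  factor \<epsilon> that the difference quotient cancels. By ln (1 + T) it is of logarithmic growth,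
  so that its exponential is polynomial; exponentiating the first bound could outgrow the decay of
  the weight.\<close>

lemma abs_exp_laguerre_log_ratio_bound:
  "\<exists>C\<ge>0. \<exists>M. \<forall>x. (\<forall>l<N. 0 < x l) \<longrightarrow> (\<forall>\<epsilon>. 0 < \<epsilon> \<and> \<epsilon> \<le> 1 \<longrightarrow>
     \<bar>exp (laguerre_log_ratio \<alpha>\<^sub>1 \<beta> N p \<epsilon> x) - 1\<bar> \<le> \<epsilon> * (C * (\<Prod>l<N. 1 + x l) ^ M))"
proof -
  \<comment> \<open>The total weight of the logarithms:
    \<open>\<bar>\<alpha>\<^sub>1\<bar> + 1\<close> for each coordinate and
    \<open>\<bar>\<beta>\<bar>\<close> for each of at most N^2 pairs. Rounded up to
    \<open>k\<close>, it becomes the degree of a power of 1 + T.\<close>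
  define K where "K = real N * (\<bar>\<alpha>\<^sub>1\<bar> + 1) + \<bar>\<beta>\<bar> * (real N * real N)"
  define k where "k = nat \<lceil>K\<rceil>"
  have K: "0 \<le> K" "K \<le> real k" unfolding k_def by (simp add: K_def, linarith)
  \<comment> \<open>The first factor comes from the bound on the absolute value of the log ratio,
    the second from 1 + T \<le> (p + 2) B^p raised to the power \<open>k\<close>.\<close>
  define C where "C = (K * real (p + 1) + real N) * real (p + 2) ^ k"
  have C: "C \<ge> 0" using K by (simp add: C_def)
  have "\<bar>exp (laguerre_log_ratio \<alpha>\<^sub>1 \<beta> N p \<epsilon> x) - 1\<bar> \<le> \<epsilon> * (C * (\<Prod>l<N. 1 + x l) ^ (p + 1 + p * k))"
    if pos': "\<forall>l<N. 0 < x l" and \<epsilon>: "0 < \<epsilon>" "\<epsilon> \<le> 1" for x \<epsilon>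
  proof -
    have pos: "0 < x l" if "l < N" for l using pos' that by simp
    define B where "B = (\<Prod>l<N. 1 + x l)"
    define T where "T = real (p + 1) * B ^ p"
    define h where "h = laguerre_log_ratio \<alpha>\<^sub>1 \<beta> N p \<epsilon> x"
    have B: "1 \<le> B" "\<And>l. l < N \<Longrightarrow> x l \<le> B"
      unfolding B_def using pos by (auto intro!: one_le_prod_one_plus le_prod_one_plus)
    then have Bp: "1 \<le> B ^ p" by (simp add: one_le_power)
    then have T: "T \<ge> 0" "1 + T \<le> real (p + 2) * B ^ p" by (auto simp: T_def algebra_simps)
    have ln: "0 \<le> ln (1 + \<epsilon> * t)" "ln (1 + \<epsilon> * t) \<le> \<epsilon> * T" "ln (1 + \<epsilon> * t) \<le> ln (1 + T)" if "0 \<le> t" "t \<le> T" for t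
    proof -
      have et: "0 \<le> \<epsilon> * t" using \<epsilon> that by simp
      show "0 \<le> ln (1 + \<epsilon> * t)" using et by simp
      have "ln (1 + \<epsilon> * t) \<le> \<epsilon> * t" by (rule ln_add_one_self_le_self[OF et])
      also have "\<dots> \<le> \<epsilon> * T" using \<epsilon> that by simp
      finally show "ln (1 + \<epsilon> * t) \<le> \<epsilon> * T" .
      have "\<epsilon> * t \<le> 1 * T" using \<epsilon> that by (intro mult_mono) auto
      then show "ln (1 + \<epsilon> * t) \<le> ln (1 + T)" using et by (subst ln_le_cancel_iff) auto
    qed
    have xp: "0 \<le> x l ^ p" "x l ^ p \<le> T" "0 \<le> real (p + 1) * x l ^ p" "real (p + 1) * x l ^ p \<le> T"
      "0 \<le> x l ^ (p + 1)" "x l ^ (p + 1) \<le> B ^ (p + 1)" if "l < N" for l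
    proof -
      have *: "0 \<le> x l" "x l ^ p \<le> B ^ p" "x l ^ (p + 1) \<le> B ^ (p + 1)"
        using pos[OF that] B(2)[OF that] by (auto intro!: power_mono simp del: power_Suc)
      then show "0 \<le> x l ^ p" "0 \<le> real (p + 1) * x l ^ p" "0 \<le> x l ^ (p + 1)" "x l ^ (p + 1) \<le> B ^ (p + 1)" by auto
      show "real (p + 1) * x l ^ p \<le> T" unfolding T_def using * by (intro mult_left_mono) auto
      then show "x l ^ p \<le> T" using * by (auto simp: algebra_simps intro: order_trans[rotated])
    qed
    have dp: "0 \<le> divided_power p (x i) (x j)" "divided_power p (x i) (x j) \<le> T" if "i < N" "j < i" for i j
      using that pos[of i] pos[of j] B(2)[of i] B(2)[of j] divided_power_le[of "x i" B "x j" p]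
      unfolding T_def by (auto intro: divided_power_nonneg)
    define P where "P = (\<Sum>i<N. \<Sum>j<i. ln (1 + \<epsilon> * divided_power p (x i) (x j)))"
    have P: "0 \<le> P" "P \<le> real N * (real N * (\<epsilon> * T))" "P \<le> real N * (real N * ln (1 + T))"
      unfolding P_def using ln dp T \<epsilon> by (auto intro!: sum_nonneg sum_pairs_le)
    have h: "h = (\<Sum>l<N. \<alpha>\<^sub>1 * ln (1 + \<epsilon> * x l ^ p) + ln (1 + \<epsilon> * (real (p + 1) * x l ^ p)) - \<epsilon> * x l ^ (p + 1)) + \<beta> * P"
      by (simp add: h_def laguerre_log_ratio_def P_def)
    \<comment> \<open>Only an upper bound is needed for the exponential, so the negative terms -
      \<epsilon> x_l^(p+1) are dropped here; they do enter the bound on the absolute value.\<close>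
    have "h \<le> (\<Sum>l<N. (\<bar>\<alpha>\<^sub>1\<bar> + 1) * ln (1 + T)) + \<bar>\<beta>\<bar> * (real N * (real N * ln (1 + T)))"
      unfolding h
    proof (rule add_mono[OF sum_mono])
      fix l assume "l \<in> {..<N}"
      then have l: "l < N" by simp
      have "\<alpha>\<^sub>1 * ln (1 + \<epsilon> * x l ^ p) \<le> \<bar>\<alpha>\<^sub>1\<bar> * ln (1 + T)"
        using ln[of "x l ^ p"] xp[OF l] by (intro mult_mono) auto
      moreover have "ln (1 + \<epsilon> * (real (p + 1) * x l ^ p)) \<le> ln (1 + T)" using ln xp[OF l] by blast
      moreover have "0 \<le> \<epsilon> * x l ^ (p + 1)" using \<epsilon> xp[OF l] by simp
      ultimately show "\<alpha>\<^sub>1 * ln (1 + \<epsilon> * x l ^ p) + ln (1 + \<epsilon> * (real (p + 1) * x l ^ p)) - \<epsilon> * x l ^ (p + 1)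
        \<le> (\<bar>\<alpha>\<^sub>1\<bar> + 1) * ln (1 + T)" by (simp add: algebra_simps)
    next
      show "\<beta> * P \<le> \<bar>\<beta>\<bar> * (real N * (real N * ln (1 + T)))"
        using P by (intro mult_mono) auto
    qed
    also have "\<dots> = K * ln (1 + T)" by (simp add: K_def algebra_simps)
    also have "\<dots> \<le> real k * ln (1 + T)" using K T by (intro mult_right_mono) auto
    also have "\<dots> = ln ((1 + T) ^ k)" using T by (simp add: ln_realpow)
    finally have "exp h \<le> exp (ln ((1 + T) ^ k))" by simp
    also have "\<dots> = (1 + T) ^ k" using T by simp
    also have "\<dots> \<le> (real (p + 2) * B ^ p) ^ k" using T by (intro power_mono) auto
    finally have exph: "exp h \<le> (real (p + 2) * B ^ p) ^ k" .
    have "\<bar>h\<bar> \<le> (\<Sum>l<N. \<epsilon> * ((\<bar>\<alpha>\<^sub>1\<bar> + 1) * T + B ^ (p + 1))) + \<bar>\<beta>\<bar> * (real N * (real N * (\<epsilon> * T)))"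
      unfolding h
    proof (rule order_trans[OF abs_triangle_ineq add_mono])
      show "\<bar>\<beta> * P\<bar> \<le> \<bar>\<beta>\<bar> * (real N * (real N * (\<epsilon> * T)))"
        using P by (simp add: abs_mult mult_left_mono)
      show "\<bar>\<Sum>l<N. \<alpha>\<^sub>1 * ln (1 + \<epsilon> * x l ^ p) + ln (1 + \<epsilon> * (real (p + 1) * x l ^ p)) - \<epsilon> * x l ^ (p + 1)\<bar>
        \<le> (\<Sum>l<N. \<epsilon> * ((\<bar>\<alpha>\<^sub>1\<bar> + 1) * T + B ^ (p + 1)))"
      proof (rule order_trans[OF sum_abs sum_mono])
        fix l assume "l \<in> {..<N}"
        then have l: "l < N" by simp
        have "\<bar>\<alpha>\<^sub>1 * ln (1 + \<epsilon> * x l ^ p)\<bar> \<le> \<bar>\<alpha>\<^sub>1\<bar> * (\<epsilon> * T)"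
          using ln[of "x l ^ p"] xp[OF l] by (simp add: abs_mult mult_left_mono)
        moreover have "0 \<le> ln (1 + \<epsilon> * (real (p + 1) * x l ^ p))" "ln (1 + \<epsilon> * (real (p + 1) * x l ^ p)) \<le> \<epsilon> * T"
          using ln xp[OF l] by blast+
        moreover have "0 \<le> \<epsilon> * x l ^ (p + 1)" "\<epsilon> * x l ^ (p + 1) \<le> \<epsilon> * B ^ (p + 1)"
          using \<epsilon> xp[OF l] by auto
        ultimately have "\<bar>\<alpha>\<^sub>1 * ln (1 + \<epsilon> * x l ^ p) + ln (1 + \<epsilon> * (real (p + 1) * x l ^ p)) - \<epsilon> * x l ^ (p + 1)\<bar>
          \<le> \<bar>\<alpha>\<^sub>1\<bar> * (\<epsilon> * T) + \<epsilon> * T + \<epsilon> * B ^ (p + 1)" by linarith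
        then show "\<bar>\<alpha>\<^sub>1 * ln (1 + \<epsilon> * x l ^ p) + ln (1 + \<epsilon> * (real (p + 1) * x l ^ p)) - \<epsilon> * x l ^ (p + 1)\<bar>
          \<le> \<epsilon> * ((\<bar>\<alpha>\<^sub>1\<bar> + 1) * T + B ^ (p + 1))" by (simp add: algebra_simps)
      qed
    qed
    also have "\<dots> = \<epsilon> * (K * T + real N * B ^ (p + 1))" by (simp add: K_def algebra_simps)
    also have "\<dots> \<le> \<epsilon> * (K * (real (p + 1) * B ^ (p + 1)) + real N * B ^ (p + 1))"
    proof -
      have "B ^ p \<le> B ^ (p + 1)" using B by (intro power_increasing) auto
      then have "T \<le> real (p + 1) * B ^ (p + 1)" unfolding T_def by (intro mult_left_mono) auto
      then show ?thesis using K \<epsilon> by (intro mult_left_mono add_right_mono) auto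
    qed
    also have "\<dots> = \<epsilon> * ((K * real (p + 1) + real N) * B ^ (p + 1))" by (simp add: algebra_simps)
    finally have absh: "\<bar>h\<bar> \<le> \<epsilon> * ((K * real (p + 1) + real N) * B ^ (p + 1))" .
    have "1 \<le> real (p + 2) * B ^ p" using T by linarith
    then have one: "1 \<le> (real (p + 2) * B ^ p) ^ k" by (rule one_le_power)
    \<comment> \<open>A mean value estimate: the absolute value of \<open>h\<close> supplies the
      factor \<epsilon>, the bound on \<open>exp h\<close> a polynomial.\<close>
    have "\<bar>exp h - 1\<bar> \<le> \<bar>h\<bar> * (real (p + 2) * B ^ p) ^ k"
      by (rule abs_exp_minus_one_le[OF exph one])
    also have "\<dots> \<le> \<epsilon> * ((K * real (p + 1) + real N) * B ^ (p + 1)) * (real (p + 2) * B ^ p) ^ k"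
      using absh one by (intro mult_right_mono) auto
    also have "\<dots> = \<epsilon> * (C * B ^ (p + 1 + p * k))"
      by (simp only: C_def power_mult_distrib power_add power_mult[symmetric] mult_ac)
    finally show ?thesis by (simp only: h_def B_def)
  qed
  with C show ?thesis by blast
qed

section \<open>The loop equation\<close>

text \<open>By invariance of the total mass every difference quotient has integral exactly 0, and
  dominated convergence passes this on to their limit.\<close>

lemma integral_laguerre_weight_ratio_deriv:
  fixes \<alpha> \<alpha>\<^sub>1 :: real
  assumes "\<alpha>\<^sub>1 > - 1" "\<alpha> > - min 1 (1 + \<alpha>\<^sub>1)" "N > 0"
  defines "\<beta> \<equiv> 2 * \<alpha> / real N"
  shows "(LINT x|PiM {..<N} (\<lambda>_. lborel). laguerre_weight \<alpha>\<^sub>1 \<beta> N x * laguerre_log_ratio_deriv \<alpha>\<^sub>1 \<beta> N p x) = 0"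
proof -
  let ?L = "PiM {..<N} (\<lambda>_. lborel :: real measure)"
  let ?w = "laguerre_weight \<alpha>\<^sub>1 \<beta> N"
  let ?H = "laguerre_log_ratio \<alpha>\<^sub>1 \<beta> N p"
  have int: "integrable ?L (\<lambda>x. (\<Prod>l<N. 1 + x l) ^ m * ?w x)" for m
    unfolding \<beta>_def by (rule integrable_laguerre_weight[OF assms(1-3)])
  have int0: "integrable ?L ?w" using int[of 0] by simp
  have int\<epsilon>: "integrable ?L (\<lambda>x. ?w x * exp (?H \<epsilon> x))" "(LINT x|?L. ?w x * exp (?H \<epsilon> x)) = integral\<^sup>L ?L ?w"
    if "\<epsilon> \<ge> 0" for \<epsilon>
  proof -
    have "(\<integral>\<^sup>+x. ennreal (?w x) \<partial>?L) < \<infinity>"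
      using int0 by (simp add: integrable_iff_bounded laguerre_weight_nonneg)
    then show "integrable ?L (\<lambda>x. ?w x * exp (?H \<epsilon> x))"
      using nn_integral_laguerre_weight_ratio[OF that]
      by (intro integrableI_nonneg) (auto simp: laguerre_weight_nonneg)
    show "(LINT x|?L. ?w x * exp (?H \<epsilon> x)) = integral\<^sup>L ?L ?w"
      using nn_integral_laguerre_weight_ratio[OF that, of N \<alpha>\<^sub>1 \<beta> p]
      by (simp add: integral_eq_nn_integral laguerre_weight_nonneg)
  qed
  obtain C M where C: "C \<ge> 0" and bound: "\<And>x \<epsilon>. (\<forall>l<N. 0 < x l) \<Longrightarrow> 0 < \<epsilon> \<Longrightarrow> \<epsilon> \<le> 1 \<Longrightarrow>
     \<bar>exp (?H \<epsilon> x) - 1\<bar> \<le> \<epsilon> * (C * (\<Prod>l<N. 1 + x l) ^ M)"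
    using abs_exp_laguerre_log_ratio_bound[of N \<alpha>\<^sub>1 \<beta> p] by blast
  define s where "s n x = ?w x * ((exp (?H (inverse (real (Suc n))) x) - 1) * real (Suc n))" for n x
  have s_meas: "s n \<in> borel_measurable ?L" for n unfolding s_def by measurable
  have s_lim: "(\<lambda>n. s n x) \<longlonglongrightarrow> ?w x * laguerre_log_ratio_deriv \<alpha>\<^sub>1 \<beta> N p x" for x
    unfolding s_def by (intro tendsto_mult_left laguerre_log_ratio_limit)
  have "(\<lambda>n. integral\<^sup>L ?L (s n)) \<longlonglongrightarrow> (LINT x|?L. ?w x * laguerre_log_ratio_deriv \<alpha>\<^sub>1 \<beta> N p x)"
  proof (rule integral_dominated_convergence)
    show "integrable ?L (\<lambda>x. C * ((\<Prod>l<N. 1 + x l) ^ M * ?w x))"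
      by (intro integrable_mult_right int)
    show "(\<lambda>x. ?w x * laguerre_log_ratio_deriv \<alpha>\<^sub>1 \<beta> N p x) \<in> borel_measurable ?L"
      by (rule borel_measurable_LIMSEQ_real[OF s_lim s_meas])
    show "AE x in ?L. norm (s n x) \<le> C * ((\<Prod>l<N. 1 + x l) ^ M * ?w x)" for n
    proof (rule AE_I2)
      fix x :: "nat \<Rightarrow> real"
      show "norm (s n x) \<le> C * ((\<Prod>l<N. 1 + x l) ^ M * ?w x)"
      proof (cases "\<forall>l<N. 0 < x l")
        case True
        have "norm (s n x) = ?w x * (\<bar>exp (?H (inverse (real (Suc n))) x) - 1\<bar> * real (Suc n))"
          by (simp add: s_def abs_mult laguerre_weight_nonneg)
        also have "\<dots> \<le> ?w x * (inverse (real (Suc n)) * (C * (\<Prod>l<N. 1 + x l) ^ M) * real (Suc n))"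
          by (intro mult_left_mono mult_right_mono bound True laguerre_weight_nonneg)
            (auto simp: inverse_le_1_iff)
        also have "\<dots> = C * ((\<Prod>l<N. 1 + x l) ^ M * ?w x)" by (simp add: field_simps)
        finally show ?thesis .
      next
        case False
        then have "?w x = 0" by (auto simp: laguerre_weight_def)
        then show ?thesis by (simp add: s_def)
      qed
    qed
  qed (use s_lim s_meas in auto)
  moreover have "integral\<^sup>L ?L (s n) = 0" for n
  proof -
    have "integral\<^sup>L ?L (s n) = (LINT x|?L. real (Suc n) * (?w x * exp (?H (inverse (real (Suc n))) x) - ?w x))"
      by (rule Bochner_Integration.integral_cong) (auto simp: s_def algebra_simps)
    also have "\<dots> = real (Suc n) * ((LINT x|?L. ?w x * exp (?H (inverse (real (Suc n))) x)) - integral\<^sup>L ?L ?w)"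
      using int\<epsilon>(1)[of "inverse (real (Suc n))"] int0 by simp
    also have "\<dots> = 0" using int\<epsilon>(2)[of "inverse (real (Suc n))"] by simp
    finally show ?thesis .
  qed
  ultimately show ?thesis by (simp add: LIMSEQ_const_iff)
qed

text \<open>The products of power sums run over ordered pairs, so they count each unordered pair
  twice, which the factor 2 in 2 c matches, and also the diagonal, which is the subtracted term with
  p + 1.\<close>

lemma laguerre_log_ratio_deriv_power_sum:
  "laguerre_log_ratio_deriv \<alpha>\<^sub>1 (2 * c) N p x =
     (\<alpha>\<^sub>1 + real (p + 1)) * power_sum N p x - power_sum N (p + 1) x +
     c * ((\<Sum>s\<le>p. power_sum N s x * power_sum N (p - s) x) - real (p + 1) * power_sum N p x)"
proof -
  have diag: "divided_power p u u = real (p + 1) * u ^ p" for u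
  proof -
    have "divided_power p u u = (\<Sum>s\<le>p. u ^ p)"
      unfolding divided_power_def by (rule sum.cong) (auto simp flip: power_add)
    then show ?thesis by simp
  qed
  have "(\<Sum>s\<le>p. power_sum N s x * power_sum N (p - s) x) =
      (\<Sum>s\<le>p. \<Sum>i<N. \<Sum>j<N. x i ^ s * x j ^ (p - s))"
    by (simp add: power_sum_def sum_product)
  also have "\<dots> = (\<Sum>i<N. \<Sum>j<N. divided_power p (x i) (x j))"
    unfolding divided_power_def by (subst sum.swap, rule sum.cong[OF refl], rule sum.swap)
  also have "\<dots> = 2 * (\<Sum>k<N. \<Sum>j<k. divided_power p (x k) (x j)) + (\<Sum>i<N. divided_power p (x i) (x i))"
    by (rule sum_symmetric) (rule divided_power_commute)
  also have "(\<Sum>i<N. divided_power p (x i) (x i)) = real (p + 1) * power_sum N p x"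
    unfolding diag by (simp add: power_sum_def sum_distrib_left)
  finally have "(\<Sum>s\<le>p. power_sum N s x * power_sum N (p - s) x) - real (p + 1) * power_sum N p x =
      2 * (\<Sum>k<N. \<Sum>j<k. divided_power p (x k) (x j))" by simp
  moreover have "(\<Sum>l<N. \<alpha>\<^sub>1 * x l ^ p + real (p + 1) * x l ^ p - x l ^ (p + 1)) =
      (\<alpha>\<^sub>1 + real (p + 1)) * power_sum N p x - power_sum N (p + 1) x"
    by (simp only: sum.distrib sum_subtractf sum_distrib_left[symmetric] power_sum_def distrib_right)
  ultimately show ?thesis
    unfolding laguerre_log_ratio_deriv_def by simp
qed

section \<open>Expectations under the ensemble as quotients of weighted integrals\<close>

lemma measurable_power_sum [measurable]: "power_sum n s \<in> borel_measurable (PiM {..<n} (\<lambda>_. lborel))"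
proof -
  have "(\<lambda>x. x l) \<in> borel_measurable (PiM {..<n} (\<lambda>_. lborel :: real measure))" if "l \<in> {..<n}" for l
    using measurable_component_singleton[of l "{..<n}" "\<lambda>_. lborel :: real measure"] that by simp
  then show ?thesis
    unfolding power_sum_def[abs_def] by (intro borel_measurable_sum borel_measurable_power)
qed

lemma power_sum_bound:
  assumes "\<forall>l<n. 0 < x l"
  shows "\<bar>power_sum n s x\<bar> \<le> real n * (\<Prod>l<n. 1 + x l) ^ s"
proof -
  have "\<bar>power_sum n s x\<bar> \<le> (\<Sum>j<n. \<bar>x j ^ s\<bar>)" unfolding power_sum_def by (rule sum_abs)
  also have "\<dots> \<le> (\<Sum>j<n. (\<Prod>l<n. 1 + x l) ^ s)"
  proof (rule sum_mono)
    fix j assume "j \<in> {..<n}"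
    then have "0 < x j" "x j \<le> (\<Prod>l<n. 1 + x l)" using assms by (auto intro!: le_prod_one_plus)
    then show "\<bar>x j ^ s\<bar> \<le> (\<Prod>l<n. 1 + x l) ^ s" by (simp add: power_mono)
  qed
  finally show ?thesis by simp
qed

lemma power_sum_0: "power_sum n 0 x = real n"
  by (simp add: power_sum_def)

context
  fixes \<alpha> \<alpha>\<^sub>1 :: real and N :: nat
  assumes params: "\<alpha>\<^sub>1 > - 1" "\<alpha> > - min 1 (1 + \<alpha>\<^sub>1)" "N > 0"
begin

lemma integral_laguerre_ensemble:
  assumes "f \<in> borel_measurable (PiM {..<N} (\<lambda>_. lborel))"
  shows "integral\<^sup>L (laguerre_ensemble \<alpha>\<^sub>1 (2 * \<alpha> / real N) N) f =
    (LINT x|PiM {..<N} (\<lambda>_. lborel). laguerre_weight \<alpha>\<^sub>1 (2 * \<alpha> / real N) N x * f x) /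
    integral\<^sup>L (PiM {..<N} (\<lambda>_. lborel)) (laguerre_weight \<alpha>\<^sub>1 (2 * \<alpha> / real N) N)"
proof -
  let ?L = "PiM {..<N} (\<lambda>_. lborel :: real measure)"
  let ?w = "laguerre_weight \<alpha>\<^sub>1 (2 * \<alpha> / real N) N"
  let ?Z = "integral\<^sup>L ?L ?w"
  have "integral\<^sup>L (laguerre_ensemble \<alpha>\<^sub>1 (2 * \<alpha> / real N) N) f = (LINT x|?L. (?w x / ?Z) *\<^sub>R f x)"
    unfolding laguerre_ensemble_def Let_def
    by (rule integral_density)
      (use assms integral_laguerre_weight_pos[OF params] in \<open>auto simp: laguerre_weight_nonneg less_imp_le\<close>)
  also have "\<dots> = (LINT x|?L. (?w x * f x) / ?Z)" by simp
  finally show ?thesis by simp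
qed

lemma integrable_laguerre_weight_power_sum_mult:
  "integrable (PiM {..<N} (\<lambda>_. lborel))
     (\<lambda>x. laguerre_weight \<alpha>\<^sub>1 (2 * \<alpha> / real N) N x * (power_sum N s x * power_sum N t x))"
proof (rule Bochner_Integration.integrable_bound)
  let ?L = "PiM {..<N} (\<lambda>_. lborel :: real measure)"
  let ?w = "laguerre_weight \<alpha>\<^sub>1 (2 * \<alpha> / real N) N"
  show "integrable ?L (\<lambda>x. (real N * real N) * ((\<Prod>l<N. 1 + x l) ^ (s + t) * ?w x))"
    by (intro integrable_mult_right integrable_laguerre_weight params)
  show "AE x in ?L. norm (?w x * (power_sum N s x * power_sum N t x)) \<le>
      norm ((real N * real N) * ((\<Prod>l<N. 1 + x l) ^ (s + t) * ?w x))"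
  proof (rule AE_I2)
    fix x :: "nat \<Rightarrow> real"
    let ?B = "\<Prod>l<N. 1 + x l"
    show "norm (?w x * (power_sum N s x * power_sum N t x)) \<le> norm ((real N * real N) * (?B ^ (s + t) * ?w x))"
    proof (cases "\<forall>l<N. 0 < x l")
      case True
      then have B: "1 \<le> ?B" by (intro one_le_prod_one_plus) auto
      have "\<bar>power_sum N s x\<bar> * \<bar>power_sum N t x\<bar> \<le> (real N * ?B ^ s) * (real N * ?B ^ t)"
        using power_sum_bound[OF True] B by (intro mult_mono) auto
      then have "?w x * (\<bar>power_sum N s x\<bar> * \<bar>power_sum N t x\<bar>) \<le> ?w x * ((real N * ?B ^ s) * (real N * ?B ^ t))"
        by (intro mult_left_mono laguerre_weight_nonneg)
      then show ?thesis
        using B by (simp add: abs_mult laguerre_weight_nonneg power_add mult_ac)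
    qed (auto simp: laguerre_weight_def)
  qed
qed measurable

lemma integrable_laguerre_weight_power_sum:
  "integrable (PiM {..<N} (\<lambda>_. lborel)) (\<lambda>x. laguerre_weight \<alpha>\<^sub>1 (2 * \<alpha> / real N) N x * power_sum N s x)"
proof -
  \<comment> \<open>The power sum of exponent 0 is the constant N, so one power sum is a product of
    two divided by N.\<close>
  have "laguerre_weight \<alpha>\<^sub>1 (2 * \<alpha> / real N) N x * power_sum N s x =
      (laguerre_weight \<alpha>\<^sub>1 (2 * \<alpha> / real N) N x * (power_sum N 0 x * power_sum N s x)) / real N" for x
    using params(3) by (simp add: power_sum_0)
  then show ?thesis
    using integrable_divide_zero[OF integrable_laguerre_weight_power_sum_mult[of 0 s], of "real N"] by simp
qed

lemma laguerre_moment_0: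
  "integral\<^sup>L (laguerre_ensemble \<alpha>\<^sub>1 (2 * \<alpha> / real N) N) (power_sum N 0) = real N"
  using integral_laguerre_weight_pos[OF params]
  by (subst integral_laguerre_ensemble) (simp_all add: power_sum_0)

lemma laguerre_loop_equation:
  defines "E \<equiv> integral\<^sup>L (laguerre_ensemble \<alpha>\<^sub>1 (2 * \<alpha> / real N) N)"
  shows "(\<alpha>\<^sub>1 + real (p + 1)) * E (power_sum N p) - E (power_sum N (p + 1)) +
    \<alpha> / real N * ((\<Sum>s\<le>p. E (\<lambda>x. power_sum N s x * power_sum N (p - s) x)) - real (p + 1) * E (power_sum N p)) = 0"
proof -
  let ?L = "PiM {..<N} (\<lambda>_. lborel :: real measure)"
  let ?w = "laguerre_weight \<alpha>\<^sub>1 (2 * \<alpha> / real N) N"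
  let ?Z = "integral\<^sup>L ?L ?w"
  note int = integrable_laguerre_weight_power_sum integrable_laguerre_weight_power_sum_mult
  have E1: "E (power_sum N s) = (LINT x|?L. ?w x * power_sum N s x) / ?Z" for s
    unfolding E_def by (rule integral_laguerre_ensemble) measurable
  have E2: "E (\<lambda>x. power_sum N s x * power_sum N t x) = (LINT x|?L. ?w x * (power_sum N s x * power_sum N t x)) / ?Z" for s t
    unfolding E_def by (rule integral_laguerre_ensemble) measurable
  have "0 = (LINT x|?L. ?w x * laguerre_log_ratio_deriv \<alpha>\<^sub>1 (2 * \<alpha> / real N) N p x)"
    using integral_laguerre_weight_ratio_deriv[OF params] by simp
  also have "\<dots> = (LINT x|?L. (\<alpha>\<^sub>1 + real (p + 1)) * (?w x * power_sum N p x) - ?w x * power_sum N (p + 1) x +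
      \<alpha> / real N * ((\<Sum>s\<le>p. ?w x * (power_sum N s x * power_sum N (p - s) x)) - real (p + 1) * (?w x * power_sum N p x)))"
  proof (rule Bochner_Integration.integral_cong[OF refl])
    fix x :: "nat \<Rightarrow> real"
    show "?w x * laguerre_log_ratio_deriv \<alpha>\<^sub>1 (2 * \<alpha> / real N) N p x =
      (\<alpha>\<^sub>1 + real (p + 1)) * (?w x * power_sum N p x) - ?w x * power_sum N (p + 1) x +
      \<alpha> / real N * ((\<Sum>s\<le>p. ?w x * (power_sum N s x * power_sum N (p - s) x)) - real (p + 1) * (?w x * power_sum N p x))"
      using laguerre_log_ratio_deriv_power_sum[of \<alpha>\<^sub>1 "\<alpha> / real N" N p x]
      by (simp add: sum_distrib_left[symmetric] del: of_nat_add) (simp add: algebra_simps)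
  qed
  also have "\<dots> = (\<alpha>\<^sub>1 + real (p + 1)) * (LINT x|?L. ?w x * power_sum N p x) - (LINT x|?L. ?w x * power_sum N (p + 1) x) +
      \<alpha> / real N * ((\<Sum>s\<le>p. LINT x|?L. ?w x * (power_sum N s x * power_sum N (p - s) x)) - real (p + 1) * (LINT x|?L. ?w x * power_sum N p x))"
    by (simp add: int del: of_nat_add)
  finally have "\<dots> / ?Z = 0" by simp
  \<comment> \<open>All expectations share the denominator \<open>?Z\<close>; this identity collects
    it, turning the relation between integrals into one between expectations.\<close>
  moreover have arith: "c * (A / z) - B / z + k * (S / z - d * (A / z)) = (c * A - B + k * (S - d * A)) / z"
    for c A B k S d z :: real
    by (simp add: diff_divide_distrib add_divide_distrib right_diff_distrib)
  ultimately show ?thesis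
    unfolding E1 E2 sum_divide_distrib[symmetric] arith by (simp only:)
qed

end

section \<open>The limit of large \<open>N\<close>\<close>

lemma partition_on_lessThan_2: "{P. partition_on {..<2::nat} P} = {{{0, 1}}, {{0}, {1}}}"
proof (intro equalityI subsetI)
  fix P assume "P \<in> {P. partition_on {..<2::nat} P}"
  then have P: "partition_on {..<2::nat} P" by simp
  have *: "{..<2::nat} = {0, 1}" by auto
  have U: "\<Union>P = {0, 1}" and d: "disjoint P" and ne: "{} \<notin> P"
    using P unfolding partition_on_def * by auto
  have sub: "B = {0} \<or> B = {1} \<or> B = {0, 1}" if "B \<in> P" for B
  proof -
    have "B \<in> Pow {0, 1}" using that U by blast
    then show ?thesis using that ne by (auto simp: Pow_insert)
  qed
  show "P \<in> {{{0, 1}}, {{0}, {1}}}"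
  proof (cases "{0, 1} \<in> P")
    case True
    have "B = {0, 1}" if "B \<in> P" for B
      using sub[OF that] disjointD[OF d that True] by auto
    then have "P = {{0, 1}}" using True by blast
    then show ?thesis by simp
  next
    case False
    then have "B = {0} \<or> B = {1}" if "B \<in> P" for B using sub[OF that] that by auto
    moreover have "\<exists>B\<in>P. 0 \<in> B" "\<exists>B\<in>P. 1 \<in> B" using U by blast+
    ultimately have "{0} \<in> P" "{1} \<in> P" "P \<subseteq> {{0}, {1}}" by fastforce+
    then show ?thesis by blast
  qed
next
  fix P :: "nat set set" assume "P \<in> {{{0, 1}}, {{0}, {1}}}"
  moreover have "{..<2::nat} = {0, 1}" by auto
  moreover have "partition_on {0, 1::nat} {{0, 1}}" "partition_on {0, 1::nat} {{0}, {1}}"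
    by (auto simp: partition_on_def disjoint_def)
  ultimately show "P \<in> {P. partition_on {..<2::nat} P}" by force
qed

text \<open>The partition into one block enters with sign + and the one into two blocks with sign -,
  which gives the covariance.\<close>

lemma joint_cumulant_2:
  "joint_cumulant M 2 X = (LINT x|M. X 0 x * X 1 x) - integral\<^sup>L M (X 0) * integral\<^sup>L M (X 1)"
proof -
  have ne: "{{0, 1}} \<noteq> {{0}, {1::nat}}" by (auto simp: doubleton_eq_iff)
  show ?thesis
    unfolding joint_cumulant_def partition_on_lessThan_2
    using ne by (simp add: card_insert_if)
qed

text \<open>By the leading term of the ansatz the covariance of two power sums is O(N), while the
  product of their means is of scale N^2. The truncation at K = 0 gives all that is needed.\<close>

lemma tendsto_laguerre_two_point:
  fixes \<alpha> \<alpha>\<^sub>1 :: real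
  assumes "large_N_ansatz \<alpha>\<^sub>1 \<alpha>"
  shows "(\<lambda>N. (LINT x|laguerre_ensemble \<alpha>\<^sub>1 (2 * \<alpha> / real N) N. power_sum N s x * power_sum N t x) / real N ^ 2)
    \<longlonglongrightarrow> mL0 \<alpha>\<^sub>1 \<alpha> s * mL0 \<alpha>\<^sub>1 \<alpha> t"
proof -
  let ?M = "\<lambda>N. laguerre_ensemble \<alpha>\<^sub>1 (2 * \<alpha> / real N) N"
  let ?E = "\<lambda>N s. integral\<^sup>L (?M N) (power_sum N s)"
  define p where "p i = (if i = 0 then s else t)" for i :: nat
  define \<kappa> where "\<kappa> N = joint_cumulant (?M N) 2 (\<lambda>i. power_sum N (p i))" for N
  have \<kappa>: "\<kappa> N = (LINT x|?M N. power_sum N s x * power_sum N t x) - ?E N s * ?E N t" for N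
    by (simp add: \<kappa>_def joint_cumulant_2 p_def)
  obtain c :: "nat \<Rightarrow> real" where c: "\<forall>K. (\<lambda>N. \<kappa> N - real N * (\<Sum>l\<le>K. c l / real N ^ l)) \<in> o(\<lambda>N. real N / real N ^ K)"
    using assms[unfolded large_N_ansatz_def, rule_format, of 2 p] unfolding \<kappa>_def by auto
  from c[rule_format, of 0] have "(\<lambda>N. \<kappa> N - real N * c 0) \<in> o(\<lambda>N. real N)" by simp
  then have "(\<lambda>N. (\<kappa> N - real N * c 0) / real N) \<longlonglongrightarrow> 0"
    by (rule smalloD_tendsto)
  \<comment> \<open>The covariance over N tends to \<open>c 0\<close>; the second factor 1 / N
    removes it.\<close>
  then have "(\<lambda>N. ((\<kappa> N - real N * c 0) / real N + c 0) * inverse (real N)) \<longlonglongrightarrow> (0 + c 0) * 0"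
    by (intro tendsto_intros tendsto_inverse_0_at_top filterlim_real_sequentially)
  then have "(\<lambda>N. ((\<kappa> N - real N * c 0) / real N + c 0) * inverse (real N) + (?E N s / real N) * (?E N t / real N))
      \<longlonglongrightarrow> 0 + mL0 \<alpha>\<^sub>1 \<alpha> s * mL0 \<alpha>\<^sub>1 \<alpha> t"
    by (intro tendsto_add tendsto_mult tendsto_mL0 assms) simp
  moreover have "eventually (\<lambda>N. ((\<kappa> N - real N * c 0) / real N + c 0) * inverse (real N) + (?E N s / real N) * (?E N t / real N)
      = (LINT x|?M N. power_sum N s x * power_sum N t x) / real N ^ 2) sequentially"
    using eventually_gt_at_top[of 0]
    by eventually_elim (simp add: \<kappa> field_simps power2_eq_square)
  ultimately show ?thesis by (simp add: tendsto_cong)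
qed

theorem mainTheorem4:
  fixes \<alpha> \<alpha>\<^sub>1 :: real
  assumes "\<alpha>\<^sub>1 > - 1"
    and "\<alpha> > - min 1 (1 + \<alpha>\<^sub>1)"
    and "large_N_ansatz \<alpha>\<^sub>1 \<alpha>"
  shows "mL0 \<alpha>\<^sub>1 \<alpha> 0 = 1 \<and>
    (\<forall>p. mL0 \<alpha>\<^sub>1 \<alpha> (p + 1) =
        (real p + 1 + \<alpha>\<^sub>1 + \<alpha>) * mL0 \<alpha>\<^sub>1 \<alpha> p
        + \<alpha> * (\<Sum>s<p. mL0 \<alpha>\<^sub>1 \<alpha> s * mL0 \<alpha>\<^sub>1 \<alpha> (p - s)))"
proof (intro conjI allI)
  let ?M = "\<lambda>N. laguerre_ensemble \<alpha>\<^sub>1 (2 * \<alpha> / real N) N"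
  let ?E = "\<lambda>N s. integral\<^sup>L (?M N) (power_sum N s)"
  let ?F = "\<lambda>N s t. LINT x|?M N. power_sum N s x * power_sum N t x"
  let ?m = "mL0 \<alpha>\<^sub>1 \<alpha>"
  have "eventually (\<lambda>N. ?E N 0 / real N = 1) sequentially"
    using eventually_gt_at_top[of 0]
    by eventually_elim (simp add: laguerre_moment_0[OF assms(1,2)])
  then have "(\<lambda>N. ?E N 0 / real N) \<longlonglongrightarrow> 1" by (rule tendsto_eventually)
  with tendsto_mL0[OF assms(3), of 0] show m0: "?m 0 = 1" by (rule LIMSEQ_unique)
  fix p
  have inv: "(\<lambda>N. inverse (real N)) \<longlonglongrightarrow> 0"
    by (intro tendsto_inverse_0_at_top filterlim_real_sequentially)
  \<comment> \<open>The loop equation divided by N. The products of power sums then appear over N^2,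
    whereas the diagonal term, a single power sum, keeps an extra 1 / N and disappears.\<close>
  have "(\<lambda>N. (\<alpha>\<^sub>1 + real (p + 1)) * (?E N p / real N) - ?E N (p + 1) / real N +
      \<alpha> * ((\<Sum>s\<le>p. ?F N s (p - s) / real N ^ 2) - real (p + 1) * (?E N p / real N) * inverse (real N)))
    \<longlonglongrightarrow> (\<alpha>\<^sub>1 + real (p + 1)) * ?m p - ?m (p + 1) +
      \<alpha> * ((\<Sum>s\<le>p. ?m s * ?m (p - s)) - real (p + 1) * ?m p * 0)"
    by (intro tendsto_add tendsto_diff tendsto_mult tendsto_sum tendsto_const tendsto_mL0 tendsto_laguerre_two_point inv assms(3))
  moreover have "eventually (\<lambda>N. (\<alpha>\<^sub>1 + real (p + 1)) * (?E N p / real N) - ?E N (p + 1) / real N +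
      \<alpha> * ((\<Sum>s\<le>p. ?F N s (p - s) / real N ^ 2) - real (p + 1) * (?E N p / real N) * inverse (real N)) = 0) sequentially"
    using eventually_gt_at_top[of 0]
  proof eventually_elim
    case (elim N)
    have "(\<alpha>\<^sub>1 + real (p + 1)) * (?E N p / real N) - ?E N (p + 1) / real N +
      \<alpha> * ((\<Sum>s\<le>p. ?F N s (p - s) / real N ^ 2) - real (p + 1) * (?E N p / real N) * inverse (real N)) =
      ((\<alpha>\<^sub>1 + real (p + 1)) * ?E N p - ?E N (p + 1) +
      \<alpha> / real N * ((\<Sum>s\<le>p. ?F N s (p - s)) - real (p + 1) * ?E N p)) / real N"
      using elim by (simp add: sum_divide_distrib[symmetric] field_simps power2_eq_square)
    also have "\<dots> = 0"
      using laguerre_loop_equation[OF assms(1,2) elim, of p] by simp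
    finally show ?case .
  qed
  ultimately have "(\<lambda>_. 0) \<longlonglongrightarrow> (\<alpha>\<^sub>1 + real (p + 1)) * ?m p - ?m (p + 1) +
      \<alpha> * ((\<Sum>s\<le>p. ?m s * ?m (p - s)) - real (p + 1) * ?m p * 0)"
    by (rule Lim_transform_eventually)
  then have "(\<alpha>\<^sub>1 + real (p + 1)) * ?m p - ?m (p + 1) + \<alpha> * (\<Sum>s\<le>p. ?m s * ?m (p - s)) = 0"
    by (simp add: LIMSEQ_const_iff)
  \<comment> \<open>The last summand carries the factor \<open>?m 0 = 1\<close>, so the first half
    of the theorem is used here. For p = 0 it is the only summand, and the remaining sum is
    empty.\<close>
  moreover have "(\<Sum>s\<le>p. ?m s * ?m (p - s)) = (\<Sum>s<p. ?m s * ?m (p - s)) + ?m p"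
    by (simp add: m0 flip: lessThan_Suc_atMost)
  ultimately show "?m (p + 1) = (real p + 1 + \<alpha>\<^sub>1 + \<alpha>) * ?m p + \<alpha> * (\<Sum>s<p. ?m s * ?m (p - s))"
    by (simp add: algebra_simps)
qed

end
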